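(* Let $\mathfrak p=\mathfrak l\ltimes\mathfrak u$ be a parabolic subalgebra of $\mathfrak g$. The cubic Dirac operator decomposes into $\mathfrak l$-invariant elements of $\mathfrak U(\mathfrak g)\otimes C(\mathfrak s)$ as $$D(\mathfrak g,\mathfrak l)=C+\overline C,\qquad C=A+1\otimes a,\quad \overline C=\overline A+1\otimes\overline a .$$
   Context: Ground field $\mathbb C$; $p(\cdot)$ denotes parity. $\mathfrak g=\mathfrak g_0\oplus\mathfrak g_1$ is a basic classical Lie superalgebra with $\mathfrak g_1\neq0$, i.e. $\mathfrak{gl}(m|n)$ ($m,n\ge1$) or simple of type $A(m|n),B(m|n),C(n),D(m|n),F(4),G(3)$ or $D(2,1;\alpha)$ with $\alpha\in\mathbb R$; $(\cdot,\cdot)$ is a fixed non-degenerate invariant supersymmetric bilinear form with $(\mathfrak g_0,\mathfrak g_1)=0$. $\mathfrak h\subset\mathfrak g_0$ is a Cartan subalgebra, $\Phi$ the roots, $\mathfrak g^\alpha$ the root spaces. Parabolic subalgebra: given an additive map $f:\mathbb Z\Phi\to\mathbb Z$, put $\mathfrak l=\mathfrak h\oplus\bigoplus_{f(\alpha)=0}\mathfrak g^\alpha$, $\mathfrak u=\bigoplus_{f(\alpha)>0}\mathfrak g^\alpha$, $\bar{\mathfrak u}=\bigoplus_{f(\alpha)<0}\mathfrak g^{\alpha}$; $\mathfrak p=\mathfrak l\ltimes\mathfrak u$, $\mathfrak s=\mathfrak u\oplus\bar{\mathfrak u}$. Cubic Dirac operator: $C(\mathfrak s)$ is the Clifford superalgebra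 generated by $\mathfrak s$ with relations $vw+(-1)^{p(v)p(w)}wv=2(v,w)$. Let $X_1,\dots,X_{2s}$ be a homogeneous basis of $\mathfrak s$ with dual basis $X_i^*$, $(X_i^*,X_j)=\delta_{ij}$. Put $\phi_{\mathfrak s}=-\frac1{12}\sum_{i,j,k}(-1)^{p(X_i)p(X_j)+p(X_k)}([X_i,X_j],X_k)\,X_i^*\wedge X_j^*\wedge X_k^*$, viewed in $C(\mathfrak s)$ via the quantization map (super-antisymmetrization) $\bigwedge\mathfrak s\cong C(\mathfrak s)$, where $\bigwedge\mathfrak s$ has relations $v\wedge w=-(-1)^{p(v)p(w)}w\wedge v$; and $D(\mathfrak g,\mathfrak l)=\sum_iX_i\otimes X_i^*+1\otimes\phi_{\mathfrak s}\in\mathfrak U(\mathfrak g)\otimes C(\mathfrak s)$ (independent of the basis). Summands: let $u_1,\dots,u_s$ be a homogeneous basis of $\mathfrak u$ and $\bar u_1,\dots,\bar u_s$ the basis of $\bar{\mathfrak u}$ with $(\bar u_i,u_j)=\delta_{ij}$. Then $A=\sum_iu_i\otimes\bar u_i$, $\overline A=\sum_i(-1)^{p(u_i)}\bar u_i\otimes u_i$, $a=-\frac14\sum_{i,j,k}(-1)^{p(u_i)p(u_j)+p(u_k)+p(u_i)+p(u_j)}([\bar u_i,\bar u_j],u_k)\,u_i\wedge u_j\wedge\bar u_k$, $\overline a=-\frac14\sum_{i,j,k}(-1)^{p(u_i)p(u_j)}([u_i,u_j],\bar u_k)\,\bar u_i\wedge\bar u_j\wedge u_k$, both viewed in $C(\mathfrak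 s)$ via the quantization map. $\mathfrak l$-invariance: $\nu_*:\mathfrak l\to C(\mathfrak s)$ is the Lie superalgebra morphism with values in the image of $\bigwedge^2\mathfrak s$ satisfying $[\nu_*(X),v]=[X,v]$ for $v\in\mathfrak s$; an element $B\in\mathfrak U(\mathfrak g)\otimes C(\mathfrak s)$ is $\mathfrak l$-invariant if it supercommutes with $X\otimes1+1\otimes\nu_*(X)$ for all $X\in\mathfrak l$. *)

theory Defs
  imports
    Complex_Main
    "HOL-Library.Poly_Mapping"
    "HOL-Combinatorics.Permutations"
    "Jordan_Normal_Form.Matrix"
begin

section \<open>Complex Lie superalgebras\<close>

text \<open>The underlying vector space is the whole type \<open>'g\<close>; parities are the numbers 0 and 1.\<close>

record 'g lsa =
  lscale :: "complex \<Rightarrow> 'g \<Rightarrow> 'g"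
  even_part :: "'g set"
  odd_part :: "'g set"
  bracket :: "'g \<Rightarrow> 'g \<Rightarrow> 'g"

definition part :: "'g lsa \<Rightarrow> nat \<Rightarrow> 'g set" where
  "part L p = (if even p then even_part L else odd_part L)"

text \<open>The parity of a homogeneous element. The zero vector, which lies in both parts, gets
  parity 0; the value on non-homogeneous elements is irrelevant.\<close>

definition par :: "('g::ab_group_add) lsa \<Rightarrow> 'g \<Rightarrow> nat" where
  "par L x = (if x \<in> odd_part L \<and> x \<noteq> 0 then 1 else 0)"

definition hom_elems :: "'g lsa \<Rightarrow> 'g set \<Rightarrow> 'g set" where
  "hom_elems L V = V \<inter> (even_part L \<union> odd_part L)"

abbreviation lspan :: "('g::ab_group_add) lsa \<Rightarrow> 'g set \<Rightarrow> 'g set" where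
  "lspan L \<equiv> Modules.module.span (lscale L)"

abbreviation lsubspace :: "('g::ab_group_add) lsa \<Rightarrow> 'g set \<Rightarrow> bool" where
  "lsubspace L \<equiv> Modules.module.subspace (lscale L)"

abbreviation lindependent :: "('g::ab_group_add) lsa \<Rightarrow> 'g set \<Rightarrow> bool" where
  "lindependent L V \<equiv> \<not> Modules.module.dependent (lscale L) V"

locale lie_superalgebra = vector_space "lscale L" for L :: "('g::ab_group_add) lsa" +
  assumes subspace_part: "subspace (part L p)"
    and even_Int_odd: "even_part L \<inter> odd_part L = {0}"
    and even_plus_odd: "\<exists>a\<in>even_part L. \<exists>b\<in>odd_part L. x = a + b"
    and bracket_add_left: "bracket L (x + y) z = bracket L x z + bracket L y z"
    and bracket_add_right: "bracket L x (y + z) = bracket L x y + bracket L x z"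
    and bracket_scale_left: "bracket L (lscale L c x) y = lscale L c (bracket L x y)"
    and bracket_scale_right: "bracket L x (lscale L c y) = lscale L c (bracket L x y)"
    and bracket_part: "x \<in> part L p \<Longrightarrow> y \<in> part L q \<Longrightarrow> bracket L x y \<in> part L (p + q)"
    and bracket_skew: "x \<in> part L p \<Longrightarrow> y \<in> part L q \<Longrightarrow>
      bracket L x y = - lscale L ((-1) ^ (p * q)) (bracket L y x)"
    and bracket_jacobi: "x \<in> part L p \<Longrightarrow> y \<in> part L q \<Longrightarrow>
      bracket L x (bracket L y z) =
        bracket L (bracket L x y) z + lscale L ((-1) ^ (p * q)) (bracket L y (bracket L x z))"

definition graded_ideal :: "('g::ab_group_add) lsa \<Rightarrow> 'g set \<Rightarrow> bool" where
  "graded_ideal L I \<longleftrightarrow> lsubspace L I \<and>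
     (\<forall>x\<in>I. \<exists>a\<in>I \<inter> even_part L. \<exists>b\<in>I \<inter> odd_part L. x = a + b) \<and>
     (\<forall>x\<in>I. \<forall>y. bracket L y x \<in> I)"

definition simple_lsa :: "('g::ab_group_add) lsa \<Rightarrow> bool" where
  "simple_lsa L \<longleftrightarrow> (\<exists>x y. bracket L x y \<noteq> 0) \<and>
     (\<forall>I. graded_ideal L I \<longrightarrow> I = {0} \<or> I = UNIV)"


section \<open>Basic classical Lie superalgebras\<close>

subsection \<open>Matrix superalgebras\<close>

definition ind_par :: "nat \<Rightarrow> nat \<Rightarrow> nat" where
  "ind_par m i = (if i < m then 0 else 1)"

definition gl_part :: "nat \<Rightarrow> nat \<Rightarrow> nat \<Rightarrow> complex mat set" where
  "gl_part m n p = {A \<in> carrier_mat (m + n) (m + n).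
     \<forall>i<m + n. \<forall>j<m + n. A $$ (i, j) \<noteq> 0 \<longrightarrow> even (ind_par m i + ind_par m j + p)}"

definition supertrace :: "nat \<Rightarrow> nat \<Rightarrow> complex mat \<Rightarrow> complex" where
  "supertrace m n A = (\<Sum>i<m + n. (-1) ^ ind_par m i * A $$ (i, i))"

definition sl_part :: "nat \<Rightarrow> nat \<Rightarrow> nat \<Rightarrow> complex mat set" where
  "sl_part m n p = {A \<in> gl_part m n p. supertrace m n A = 0}"

text \<open>The Gram matrix of an even non-degenerate supersymmetric form on the superspace of
  dimension \<open>m|2n\<close>: symmetric on the even part, symplectic on the odd part.\<close>

definition osp_gram :: "nat \<Rightarrow> nat \<Rightarrow> complex mat" where
  "osp_gram m n = mat (m + 2 * n) (m + 2 * n) (\<lambda>(i, j).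
     if i < m then (if j = i then 1 else 0)
     else if j = i + n then 1
     else if m \<le> j \<and> i = j + n then -1
     else 0)"

text \<open>With \<open>b\<close> the form of Gram matrix \<open>osp_gram m n\<close> and \<open>e\<^sub>i\<close> the standard basis, the condition
  reads \<open>b (A e\<^sub>i) e\<^sub>j + (-1)^(p p(e\<^sub>i)) b e\<^sub>i (A e\<^sub>j) = 0\<close>.\<close>

definition osp_part :: "nat \<Rightarrow> nat \<Rightarrow> nat \<Rightarrow> complex mat set" where
  "osp_part m n p = {A \<in> gl_part m (2 * n) p. \<forall>i<m + 2 * n. \<forall>j<m + 2 * n.
     (transpose_mat A * osp_gram m n) $$ (i, j)
       + (-1) ^ (p * ind_par m i) * (osp_gram m n * A) $$ (i, j) = 0}"

text \<open>\<open>L\<close> is isomorphic, through \<open>\<rho>\<close>, to the quotient by \<open>Z\<close> of the Lie superalgebra of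
  matrices with even part \<open>K 0\<close> and odd part \<open>K 1\<close> under the supercommutator.\<close>

definition mat_quotient_iso ::
  "('g::ab_group_add) lsa \<Rightarrow> (nat \<Rightarrow> complex mat set) \<Rightarrow> complex mat set \<Rightarrow> (complex mat \<Rightarrow> 'g) \<Rightarrow> bool"
  where
  "mat_quotient_iso L K Z \<rho> \<longleftrightarrow>
     (let S = {A + B | A B. A \<in> K 0 \<and> B \<in> K 1} in
       (\<forall>A\<in>S. \<forall>B\<in>S. \<rho> (A + B) = \<rho> A + \<rho> B) \<and>
       (\<forall>A\<in>S. \<forall>c. \<rho> (c \<cdot>\<^sub>m A) = lscale L c (\<rho> A)) \<and>
       \<rho> ` K 0 = even_part L \<and> \<rho> ` K 1 = odd_part L \<and>
       {A\<in>S. \<rho> A = 0} = Z \<and>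
       (\<forall>p\<in>{0, 1}. \<forall>q\<in>{0, 1}. \<forall>A\<in>K p. \<forall>B\<in>K q.
         \<rho> (A * B - (-1) ^ (p * q) \<cdot>\<^sub>m (B * A)) = bracket L (\<rho> A) (\<rho> B)))"

definition is_gl :: "nat \<Rightarrow> nat \<Rightarrow> ('g::ab_group_add) lsa \<Rightarrow> bool" where
  "is_gl m n L \<longleftrightarrow> m \<ge> 1 \<and> n \<ge> 1 \<and> (\<exists>\<rho>. mat_quotient_iso L (gl_part m n) {0\<^sub>m (m + n) (m + n)} \<rho>)"

text \<open>For \<open>m \<noteq> n\<close> the only scalar matrix of supertrace 0 is 0, so the quotient below is
  \<open>sl(m+1|n+1)\<close>; for \<open>m = n\<close> it is \<open>psl(n+1|n+1)\<close>.\<close>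

definition is_type_A :: "nat \<Rightarrow> nat \<Rightarrow> ('g::ab_group_add) lsa \<Rightarrow> bool" where
  "is_type_A m n L \<longleftrightarrow> m + n \<ge> 1 \<and>
     (\<exists>\<rho>. mat_quotient_iso L (sl_part (m + 1) (n + 1))
        {A \<in> sl_part (m + 1) (n + 1) 0. \<exists>c. A = c \<cdot>\<^sub>m 1\<^sub>m (m + 1 + (n + 1))} \<rho>)"

definition is_osp :: "nat \<Rightarrow> nat \<Rightarrow> ('g::ab_group_add) lsa \<Rightarrow> bool" where
  "is_osp m n L \<longleftrightarrow> (\<exists>\<rho>. mat_quotient_iso L (osp_part m n) {0\<^sub>m (m + 2 * n) (m + 2 * n)} \<rho>)"

definition is_type_B :: "nat \<Rightarrow> nat \<Rightarrow> ('g::ab_group_add) lsa \<Rightarrow> bool" where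
  "is_type_B m n L \<longleftrightarrow> n \<ge> 1 \<and> is_osp (2 * m + 1) n L"

definition is_type_C :: "nat \<Rightarrow> ('g::ab_group_add) lsa \<Rightarrow> bool" where
  "is_type_C n L \<longleftrightarrow> n \<ge> 2 \<and> is_osp 2 (n - 1) L"

definition is_type_D :: "nat \<Rightarrow> nat \<Rightarrow> ('g::ab_group_add) lsa \<Rightarrow> bool" where
  "is_type_D m n L \<longleftrightarrow> m \<ge> 2 \<and> n \<ge> 1 \<and> is_osp (2 * m) n L"

subsection \<open>Exceptional types\<close>

text \<open>The exceptional algebras are the simple contragredient Lie superalgebras of Kac's Cartan
  matrices; \<open>\<tau>\<close> is the set of odd nodes. If \<open>A\<close> is indecomposable, the algebra defined by the
  relations below has a unique maximal graded ideal, so the conditions determine \<open>L\<close> up to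
  isomorphism.\<close>

definition simple_contragredient ::
  "nat \<Rightarrow> (nat \<Rightarrow> nat \<Rightarrow> complex) \<Rightarrow> nat set \<Rightarrow> ('g::ab_group_add) lsa \<Rightarrow> bool" where
  "simple_contragredient r A \<tau> L \<longleftrightarrow> simple_lsa L \<and> (\<exists>e f h.
     (\<forall>i<r. h i \<in> even_part L \<and> e i \<in> part L (if i \<in> \<tau> then 1 else 0)
            \<and> f i \<in> part L (if i \<in> \<tau> then 1 else 0)) \<and>
     (\<forall>i<r. \<forall>j<r.
        bracket L (e i) (f j) = (if i = j then h i else 0) \<and>
        bracket L (h i) (h j) = 0 \<and>
        bracket L (h i) (e j) = lscale L (A i j) (e j) \<and>
        bracket L (h i) (f j) = - lscale L (A i j) (f j)) \<and>
     (\<forall>S. lsubspace L S \<and> (\<forall>x\<in>S. \<forall>y\<in>S. bracket L x y \<in> S) \<and> (\<forall>i<r. e i \<in> S \<and> f i \<in> S)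
        \<longrightarrow> S = UNIV))"

definition rows :: "complex list list \<Rightarrow> nat \<Rightarrow> nat \<Rightarrow> complex" where
  "rows M i j = M ! i ! j"

definition is_F4 :: "('g::ab_group_add) lsa \<Rightarrow> bool" where
  "is_F4 L \<longleftrightarrow> simple_contragredient 4
     (rows [[0, 1, 0, 0], [-1, 2, -2, 0], [0, -1, 2, -1], [0, 0, -1, 2]]) {0} L"

definition is_G3 :: "('g::ab_group_add) lsa \<Rightarrow> bool" where
  "is_G3 L \<longleftrightarrow> simple_contragredient 3 (rows [[0, 1, 0], [-1, 2, -3], [0, -1, 2]]) {0} L"

definition is_D21 :: "real \<Rightarrow> ('g::ab_group_add) lsa \<Rightarrow> bool" where
  "is_D21 \<alpha> L \<longleftrightarrow> \<alpha> \<noteq> 0 \<and> \<alpha> \<noteq> -1 \<and>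
     simple_contragredient 3 (rows [[0, 1, complex_of_real \<alpha>], [-1, 2, 0], [-1, 0, 2]]) {0} L"

definition basic_classical :: "('g::ab_group_add) lsa \<Rightarrow> bool" where
  "basic_classical L \<longleftrightarrow> lie_superalgebra L \<and>
     ((\<exists>m n. is_gl m n L) \<or> (\<exists>m n. is_type_A m n L) \<or> (\<exists>m n. is_type_B m n L) \<or>
      (\<exists>n. is_type_C n L) \<or> (\<exists>m n. is_type_D m n L) \<or>
      is_F4 L \<or> is_G3 L \<or> (\<exists>\<alpha>. is_D21 \<alpha> L))"

definition invariant_form :: "('g::ab_group_add) lsa \<Rightarrow> ('g \<Rightarrow> 'g \<Rightarrow> complex) \<Rightarrow> bool" where
  "invariant_form L B \<longleftrightarrow>
     (\<forall>x y z. B (x + y) z = B x z + B y z \<and> B x (y + z) = B x y + B x z) \<and>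
     (\<forall>c x y. B (lscale L c x) y = c * B x y \<and> B x (lscale L c y) = c * B x y) \<and>
     (\<forall>x. (\<forall>y. B x y = 0) \<longrightarrow> x = 0) \<and>
     (\<forall>x y z. B (bracket L x y) z = B x (bracket L y z)) \<and>
     (\<forall>p q. \<forall>x\<in>part L p. \<forall>y\<in>part L q. B x y = (-1) ^ (p * q) * B y x) \<and>
     (\<forall>x\<in>even_part L. \<forall>y\<in>odd_part L. B x y = 0)"


section \<open>Cartan subalgebras, roots and parabolic subalgebras\<close>

text \<open>Functionals on \<open>h\<close> are functions on \<open>'g\<close> that vanish outside \<open>h\<close>, so that each functional
  has a unique representative and functionals are added pointwise.\<close>

definition functional_on :: "('g::ab_group_add) lsa \<Rightarrow> 'g set \<Rightarrow> ('g \<Rightarrow> complex) \<Rightarrow> bool" where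
  "functional_on L h \<alpha> \<longleftrightarrow>
     (\<forall>x\<in>h. \<forall>y\<in>h. \<alpha> (x + y) = \<alpha> x + \<alpha> y) \<and>
     (\<forall>c. \<forall>x\<in>h. \<alpha> (lscale L c x) = c * \<alpha> x) \<and> (\<forall>x. x \<notin> h \<longrightarrow> \<alpha> x = 0)"

definition weight_space :: "('g::ab_group_add) lsa \<Rightarrow> 'g set \<Rightarrow> ('g \<Rightarrow> complex) \<Rightarrow> 'g set" where
  "weight_space L h \<alpha> = {x. \<forall>t\<in>h. bracket L t x = lscale L (\<alpha> t) x}"

text \<open>A Cartan subalgebra of \<open>even_part L\<close>, as for reductive Lie algebras: abelian, equal to its
  centralizer in the even part, and acting diagonalizably.\<close>

definition cartan_subalgebra :: "('g::ab_group_add) lsa \<Rightarrow> 'g set \<Rightarrow> bool" where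
  "cartan_subalgebra L h \<longleftrightarrow> lsubspace L h \<and> h \<subseteq> even_part L \<and>
     (\<forall>x\<in>h. \<forall>y\<in>h. bracket L x y = 0) \<and>
     (\<forall>x\<in>even_part L. (\<forall>y\<in>h. bracket L x y = 0) \<longrightarrow> x \<in> h) \<and>
     lspan L (\<Union>\<alpha>\<in>{\<alpha>. functional_on L h \<alpha>}. weight_space L h \<alpha>) = UNIV"

definition roots :: "('g::ab_group_add) lsa \<Rightarrow> 'g set \<Rightarrow> ('g \<Rightarrow> complex) set" where
  "roots L h = {\<alpha>. functional_on L h \<alpha> \<and> (\<exists>t. \<alpha> t \<noteq> 0) \<and> weight_space L h \<alpha> \<noteq> {0}}"

inductive_set root_lattice :: "('g::ab_group_add) lsa \<Rightarrow> 'g set \<Rightarrow> ('g \<Rightarrow> complex) set"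
  for L h where
  zero: "(\<lambda>t. 0) \<in> root_lattice L h"
| add: "\<alpha> \<in> root_lattice L h \<Longrightarrow> \<beta> \<in> roots L h \<Longrightarrow> (\<lambda>t. \<alpha> t + \<beta> t) \<in> root_lattice L h"
| diff: "\<alpha> \<in> root_lattice L h \<Longrightarrow> \<beta> \<in> roots L h \<Longrightarrow> (\<lambda>t. \<alpha> t - \<beta> t) \<in> root_lattice L h"

definition additive_on_lattice ::
  "('g::ab_group_add) lsa \<Rightarrow> 'g set \<Rightarrow> (('g \<Rightarrow> complex) \<Rightarrow> int) \<Rightarrow> bool" where
  "additive_on_lattice L h f \<longleftrightarrow>
     (\<forall>\<alpha>\<in>root_lattice L h. \<forall>\<beta>\<in>root_lattice L h. f (\<lambda>t. \<alpha> t + \<beta> t) = f \<alpha> + f \<beta>)"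

definition levi ::
  "('g::ab_group_add) lsa \<Rightarrow> 'g set \<Rightarrow> (('g \<Rightarrow> complex) \<Rightarrow> int) \<Rightarrow> 'g set" where
  "levi L h f = lspan L (h \<union> (\<Union>\<alpha>\<in>{\<alpha>\<in>roots L h. f \<alpha> = 0}. weight_space L h \<alpha>))"

definition nilrad ::
  "('g::ab_group_add) lsa \<Rightarrow> 'g set \<Rightarrow> (('g \<Rightarrow> complex) \<Rightarrow> int) \<Rightarrow> 'g set" where
  "nilrad L h f = lspan L (\<Union>\<alpha>\<in>{\<alpha>\<in>roots L h. f \<alpha> > 0}. weight_space L h \<alpha>)"

definition opp_nilrad ::
  "('g::ab_group_add) lsa \<Rightarrow> 'g set \<Rightarrow> (('g \<Rightarrow> complex) \<Rightarrow> int) \<Rightarrow> 'g set" where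
  "opp_nilrad L h f = lspan L (\<Union>\<alpha>\<in>{\<alpha>\<in>roots L h. f \<alpha> < 0}. weight_space L h \<alpha>)"

definition complement ::
  "('g::ab_group_add) lsa \<Rightarrow> 'g set \<Rightarrow> (('g \<Rightarrow> complex) \<Rightarrow> int) \<Rightarrow> 'g set" where
  "complement L h f = {x + y | x y. x \<in> nilrad L h f \<and> y \<in> opp_nilrad L h f}"

definition indexed_basis ::
  "('g::ab_group_add) lsa \<Rightarrow> 'g set \<Rightarrow> nat \<Rightarrow> (nat \<Rightarrow> 'g) \<Rightarrow> bool" where
  "indexed_basis L V n X \<longleftrightarrow>
     inj_on X {..<n} \<and> lindependent L (X ` {..<n}) \<and> lspan L (X ` {..<n}) = V"

definition homogeneous_basis ::
  "('g::ab_group_add) lsa \<Rightarrow> 'g set \<Rightarrow> nat \<Rightarrow> (nat \<Rightarrow> 'g) \<Rightarrow> bool" where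
  "homogeneous_basis L V n X \<longleftrightarrow> indexed_basis L V n X \<and> (\<forall>i<n. X i \<in> hom_elems L V)"

definition dual_basis ::
  "('g::ab_group_add) lsa \<Rightarrow> ('g \<Rightarrow> 'g \<Rightarrow> complex) \<Rightarrow> 'g set \<Rightarrow> nat \<Rightarrow> (nat \<Rightarrow> 'g) \<Rightarrow> (nat \<Rightarrow> 'g) \<Rightarrow> bool"
  where
  "dual_basis L B V n X Y \<longleftrightarrow> indexed_basis L V n Y \<and>
     (\<forall>i<n. \<forall>j<n. B (Y i) (X j) = (if i = j then 1 else 0))"


section \<open>Free superalgebras and their quotients\<close>

text \<open>Words form the free monoid, written additively because the exponents of
  \<open>\<Rightarrow>\<^sub>0\<close> are; so \<open>'a word \<Rightarrow>\<^sub>0 complex\<close> with its convolution product is the free unital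
  associative algebra on \<open>'a\<close>.\<close>

datatype 'a word = Word (letters: "'a list")

instantiation word :: (type) monoid_add
begin

definition zero_word :: "'a word" where "0 = Word []"

definition plus_word :: "'a word \<Rightarrow> 'a word \<Rightarrow> 'a word" where
  "v + w = Word (letters v @ letters w)"

instance
  by standard (simp_all add: zero_word_def plus_word_def)

end

type_synonym 'a free = "'a word \<Rightarrow>\<^sub>0 complex"

definition gen :: "'a \<Rightarrow> 'a free" where
  "gen x = Poly_Mapping.single (Word [x]) 1"

definition scal :: "complex \<Rightarrow> ('k \<Rightarrow>\<^sub>0 complex) \<Rightarrow> ('k \<Rightarrow>\<^sub>0 complex)" where
  "scal c a = Poly_Mapping.map ((*) c) a"

definition bilinear_ext ::
  "('k \<Rightarrow> 'l \<Rightarrow> ('m \<Rightarrow>\<^sub>0 complex)) \<Rightarrow> ('k \<Rightarrow>\<^sub>0 complex) \<Rightarrow> ('l \<Rightarrow>\<^sub>0 complex) \<Rightarrow> ('m \<Rightarrow>\<^sub>0 complex)" where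
  "bilinear_ext \<phi> a b = (\<Sum>k\<in>Poly_Mapping.keys a. \<Sum>l\<in>Poly_Mapping.keys b.
     scal (Poly_Mapping.lookup a k * Poly_Mapping.lookup b l) (\<phi> k l))"

text \<open>The quotients below are taken of the free algebra on the homogeneous elements \<open>H\<close> of a
  superspace; their elements are represented by elements of \<open>free_on H\<close>, and equality in the
  quotient is congruence modulo the ideal.\<close>

definition free_on :: "'a set \<Rightarrow> 'a free set" where
  "free_on H = {a. \<forall>w\<in>Poly_Mapping.keys a. set (letters w) \<subseteq> H}"

inductive_set two_sided_ideal :: "'a set \<Rightarrow> 'a free set \<Rightarrow> 'a free set"
  for H R where
  zero: "0 \<in> two_sided_ideal H R"
| relator: "r \<in> R \<Longrightarrow> r \<in> two_sided_ideal H R"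
| add: "x \<in> two_sided_ideal H R \<Longrightarrow> y \<in> two_sided_ideal H R \<Longrightarrow> x + y \<in> two_sided_ideal H R"
| mult: "x \<in> two_sided_ideal H R \<Longrightarrow> a \<in> free_on H \<Longrightarrow> b \<in> free_on H \<Longrightarrow>
    a * x * b \<in> two_sided_ideal H R"

definition word_par :: "('g::ab_group_add) lsa \<Rightarrow> 'g word \<Rightarrow> nat" where
  "word_par L w = (\<Sum>x\<leftarrow>letters w. par L x)"

definition free_part :: "('g::ab_group_add) lsa \<Rightarrow> nat \<Rightarrow> 'g free set" where
  "free_part L p = {a. \<forall>w\<in>Poly_Mapping.keys a. even (word_par L w + p)}"

definition supercomm :: "('g::ab_group_add) lsa \<Rightarrow> 'g free \<Rightarrow> 'g free \<Rightarrow> 'g free" where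
  "supercomm L = bilinear_ext (\<lambda>v w. Poly_Mapping.single (v + w) 1
     - Poly_Mapping.single (w + v) ((-1) ^ (word_par L v * word_par L w)))"

text \<open>The relators of the tensor algebra: generators depend linearly on the vector.\<close>

definition linear_relators :: "('g::ab_group_add) lsa \<Rightarrow> 'g set \<Rightarrow> 'g free set" where
  "linear_relators L H =
     {gen (x + y) - gen x - gen y | x y p. x \<in> H \<inter> part L p \<and> y \<in> H \<inter> part L p} \<union>
     {gen (lscale L c x) - scal c (gen x) | c x. x \<in> H}"

text \<open>The universal enveloping superalgebra is \<open>free_on (hom_elems L UNIV)\<close> modulo
  \<open>uea_ideal L\<close>.\<close>

definition uea_ideal :: "('g::ab_group_add) lsa \<Rightarrow> 'g free set" where
  "uea_ideal L = (let H = hom_elems L UNIV in two_sided_ideal H (linear_relators L H \<union>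
     {gen x * gen y - scal ((-1) ^ (par L x * par L y)) (gen y * gen x) - gen (bracket L x y)
       | x y. x \<in> H \<and> y \<in> H}))"

text \<open>The Clifford superalgebra of the superspace \<open>S\<close> is \<open>free_on (hom_elems L S)\<close> modulo
  \<open>clifford_ideal L B S\<close>.\<close>

definition clifford_ideal ::
  "('g::ab_group_add) lsa \<Rightarrow> ('g \<Rightarrow> 'g \<Rightarrow> complex) \<Rightarrow> 'g set \<Rightarrow> 'g free set" where
  "clifford_ideal L B S = (let H = hom_elems L S in two_sided_ideal H (linear_relators L H \<union>
     {gen v * gen w + scal ((-1) ^ (par L v * par L w)) (gen w * gen v) - scal (2 * B v w) 1
       | v w. v \<in> H \<and> w \<in> H}))"

text \<open>The image in the Clifford superalgebra of \<open>v\<^sub>1 \<and> \<dots> \<and> v\<^sub>n\<close>, for homogeneous \<open>v\<^sub>i\<close>, under the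
  quantization map. The sign attached to \<open>\<pi>\<close> is the one that relates
  \<open>v\<^sub>\<pi>\<^sub>1 \<and> \<dots> \<and> v\<^sub>\<pi>\<^sub>n\<close> to \<open>v\<^sub>1 \<and> \<dots> \<and> v\<^sub>n\<close>, where \<open>v \<and> w = -(-1)^(p(v)p(w)) w \<and> v\<close>.\<close>

definition quant_wedge :: "('g::ab_group_add) lsa \<Rightarrow> 'g list \<Rightarrow> 'g free" where
  "quant_wedge L vs = (let n = length vs in scal (1 / fact n) (\<Sum>\<pi> | \<pi> permutes {..<n}.
     scal (\<Prod>(i, j)\<in>{(i, j). i < j \<and> j < n \<and> \<pi> j < \<pi> i}.
             - ((-1) ^ (par L (vs ! \<pi> i) * par L (vs ! \<pi> j))))
          (\<Prod>i\<leftarrow>[0..<n]. gen (vs ! \<pi> i))))"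

definition wedge2_image :: "('g::ab_group_add) lsa \<Rightarrow> 'g set \<Rightarrow> 'g free set" where
  "wedge2_image L S = Modules.module.span scal
     {quant_wedge L [v, w] | v w. v \<in> hom_elems L S \<and> w \<in> hom_elems L S}"


section \<open>The superalgebra \<open>U(g) \<otimes> C(s)\<close>\<close>

text \<open>The tensor product of two quotients \<open>F/I\<close> and \<open>F'/J\<close> of free superalgebras is realized as
  \<open>(F \<otimes> F')/(I \<otimes> F' + F \<otimes> J)\<close>, where \<open>F \<otimes> F'\<close> has the pairs of words as a basis.\<close>

type_synonym 'g free2 = "('g word \<times> 'g word) \<Rightarrow>\<^sub>0 complex"

definition tensor :: "'g free \<Rightarrow> 'g free \<Rightarrow> 'g free2" where
  "tensor = bilinear_ext (\<lambda>v w. Poly_Mapping.single (v, w) 1)"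

inductive_set tensor_ideal ::
  "'g set \<Rightarrow> 'g free set \<Rightarrow> 'g set \<Rightarrow> 'g free set \<Rightarrow> 'g free2 set"
  for H I H' J where
  zero: "0 \<in> tensor_ideal H I H' J"
| left: "a \<in> I \<Longrightarrow> b \<in> free_on H' \<Longrightarrow> tensor a b \<in> tensor_ideal H I H' J"
| right: "a \<in> free_on H \<Longrightarrow> b \<in> J \<Longrightarrow> tensor a b \<in> tensor_ideal H I H' J"
| add: "x \<in> tensor_ideal H I H' J \<Longrightarrow> y \<in> tensor_ideal H I H' J \<Longrightarrow> x + y \<in> tensor_ideal H I H' J"

definition tensor_mult :: "('g::ab_group_add) lsa \<Rightarrow> 'g free2 \<Rightarrow> 'g free2 \<Rightarrow> 'g free2" where
  "tensor_mult L = bilinear_ext (\<lambda>(v, w) (v', w').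
     Poly_Mapping.single (v + v', w + w') ((-1) ^ (word_par L w * word_par L v')))"

definition tensor_supercomm :: "('g::ab_group_add) lsa \<Rightarrow> 'g free2 \<Rightarrow> 'g free2 \<Rightarrow> 'g free2" where
  "tensor_supercomm L = bilinear_ext (\<lambda>x y.
     tensor_mult L (Poly_Mapping.single x 1) (Poly_Mapping.single y 1)
     - scal ((-1) ^ ((word_par L (fst x) + word_par L (snd x)) * (word_par L (fst y) + word_par L (snd y))))
         (tensor_mult L (Poly_Mapping.single y 1) (Poly_Mapping.single x 1)))"

definition uc_ideal ::
  "('g::ab_group_add) lsa \<Rightarrow> ('g \<Rightarrow> 'g \<Rightarrow> complex) \<Rightarrow> 'g set \<Rightarrow> 'g free2 set" where
  "uc_ideal L B S = tensor_ideal (hom_elems L UNIV) (uea_ideal L) (hom_elems L S) (clifford_ideal L B S)"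

definition uc_eq ::
  "('g::ab_group_add) lsa \<Rightarrow> ('g \<Rightarrow> 'g \<Rightarrow> complex) \<Rightarrow> 'g set \<Rightarrow> 'g free2 \<Rightarrow> 'g free2 \<Rightarrow> bool" where
  "uc_eq L B S x y \<longleftrightarrow> x - y \<in> uc_ideal L B S"

text \<open>\<open>\<nu>\<close> represents the even Lie superalgebra morphism from \<open>l\<close> to the Clifford superalgebra of
  \<open>S\<close> with values in the image of the second exterior power and
  \<open>[\<nu> X, v] = [X, v]\<close> for \<open>v \<in> S\<close>.\<close>

definition is_nu ::
  "('g::ab_group_add) lsa \<Rightarrow> ('g \<Rightarrow> 'g \<Rightarrow> complex) \<Rightarrow> 'g set \<Rightarrow> 'g set \<Rightarrow> ('g \<Rightarrow> 'g free) \<Rightarrow> bool" where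
  "is_nu L B S l \<nu> \<longleftrightarrow> (let J = clifford_ideal L B S in
     (\<forall>X\<in>l. \<nu> X \<in> free_on (hom_elems L S)) \<and>
     (\<forall>X\<in>l. \<forall>Y\<in>l. \<nu> (X + Y) - (\<nu> X + \<nu> Y) \<in> J) \<and>
     (\<forall>c. \<forall>X\<in>l. \<nu> (lscale L c X) - scal c (\<nu> X) \<in> J) \<and>
     (\<forall>X\<in>l. \<forall>Y\<in>l. \<nu> (bracket L X Y) - supercomm L (\<nu> X) (\<nu> Y) \<in> J) \<and>
     (\<forall>X\<in>hom_elems L l. \<exists>b\<in>wedge2_image L S \<inter> free_part L (par L X). \<nu> X - b \<in> J) \<and>
     (\<forall>X\<in>hom_elems L l. \<forall>v\<in>hom_elems L S.
        supercomm L (\<nu> X) (gen v) - gen (bracket L X v) \<in> J))"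

text \<open>It suffices to test homogeneous \<open>X\<close>, as \<open>l\<close> is a graded subspace.\<close>

definition l_invariant ::
  "('g::ab_group_add) lsa \<Rightarrow> ('g \<Rightarrow> 'g \<Rightarrow> complex) \<Rightarrow> 'g set \<Rightarrow> 'g set \<Rightarrow> ('g \<Rightarrow> 'g free) \<Rightarrow> 'g free2 \<Rightarrow> bool"
  where
  "l_invariant L B S l \<nu> x \<longleftrightarrow> (\<forall>X\<in>hom_elems L l.
     uc_eq L B S (tensor_supercomm L (tensor (gen X) 1 + tensor 1 (\<nu> X)) x) 0)"


section \<open>The cubic Dirac operator and its summands\<close>

definition dirac_cubic ::
  "('g::ab_group_add) lsa \<Rightarrow> ('g \<Rightarrow> 'g \<Rightarrow> complex) \<Rightarrow> nat \<Rightarrow> (nat \<Rightarrow> 'g) \<Rightarrow> (nat \<Rightarrow> 'g) \<Rightarrow> 'g free" where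
  "dirac_cubic L B n X X' = scal (- 1 / 12) (\<Sum>i<n. \<Sum>j<n. \<Sum>k<n.
     scal ((-1) ^ (par L (X i) * par L (X j) + par L (X k)) * B (bracket L (X i) (X j)) (X k))
       (quant_wedge L [X' i, X' j, X' k]))"

definition cubic_dirac ::
  "('g::ab_group_add) lsa \<Rightarrow> ('g \<Rightarrow> 'g \<Rightarrow> complex) \<Rightarrow> nat \<Rightarrow> (nat \<Rightarrow> 'g) \<Rightarrow> (nat \<Rightarrow> 'g) \<Rightarrow> 'g free2" where
  "cubic_dirac L B n X X' =
     (\<Sum>i<n. tensor (gen (X i)) (gen (X' i))) + tensor 1 (dirac_cubic L B n X X')"

definition op_A :: "nat \<Rightarrow> (nat \<Rightarrow> 'g) \<Rightarrow> (nat \<Rightarrow> 'g) \<Rightarrow> 'g free2" where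
  "op_A s u u' = (\<Sum>i<s. tensor (gen (u i)) (gen (u' i)))"

definition op_A_bar ::
  "('g::ab_group_add) lsa \<Rightarrow> nat \<Rightarrow> (nat \<Rightarrow> 'g) \<Rightarrow> (nat \<Rightarrow> 'g) \<Rightarrow> 'g free2" where
  "op_A_bar L s u u' = (\<Sum>i<s. scal ((-1) ^ par L (u i)) (tensor (gen (u' i)) (gen (u i))))"

definition op_a ::
  "('g::ab_group_add) lsa \<Rightarrow> ('g \<Rightarrow> 'g \<Rightarrow> complex) \<Rightarrow> nat \<Rightarrow> (nat \<Rightarrow> 'g) \<Rightarrow> (nat \<Rightarrow> 'g) \<Rightarrow> 'g free" where
  "op_a L B s u u' = scal (- 1 / 4) (\<Sum>i<s. \<Sum>j<s. \<Sum>k<s.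
     scal ((-1) ^ (par L (u i) * par L (u j) + par L (u k) + par L (u i) + par L (u j))
           * B (bracket L (u' i) (u' j)) (u k))
       (quant_wedge L [u i, u j, u' k]))"

definition op_a_bar ::
  "('g::ab_group_add) lsa \<Rightarrow> ('g \<Rightarrow> 'g \<Rightarrow> complex) \<Rightarrow> nat \<Rightarrow> (nat \<Rightarrow> 'g) \<Rightarrow> (nat \<Rightarrow> 'g) \<Rightarrow> 'g free" where
  "op_a_bar L B s u u' = scal (- 1 / 4) (\<Sum>i<s. \<Sum>j<s. \<Sum>k<s.
     scal ((-1) ^ (par L (u i) * par L (u j)) * B (bracket L (u i) (u j)) (u' k))
       (quant_wedge L [u' i, u' j, u k]))"

definition op_C ::
  "('g::ab_group_add) lsa \<Rightarrow> ('g \<Rightarrow> 'g \<Rightarrow> complex) \<Rightarrow> nat \<Rightarrow> (nat \<Rightarrow> 'g) \<Rightarrow> (nat \<Rightarrow> 'g) \<Rightarrow> 'g free2" where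
  "op_C L B s u u' = op_A s u u' + tensor 1 (op_a L B s u u')"

definition op_C_bar ::
  "('g::ab_group_add) lsa \<Rightarrow> ('g \<Rightarrow> 'g \<Rightarrow> complex) \<Rightarrow> nat \<Rightarrow> (nat \<Rightarrow> 'g) \<Rightarrow> (nat \<Rightarrow> 'g) \<Rightarrow> 'g free2" where
  "op_C_bar L B s u u' = op_A_bar L s u u' + tensor 1 (op_a_bar L B s u u')"

end

theory Submission
  imports Defs
begin

text \<open>For a dual pair of bases \<open>e\<close>, \<open>e'\<close> of isotropic subspaces that are stable under an element
  \<open>X\<close>, the tensor \<open>\<Sum>i. e\<^sub>i \<otimes> e'\<^sub>i\<close> is \<open>X\<close>-invariant, and on \<open>s\<close> it does not depend on the basis.
  All operators are contractions of two such tensors, \<open>\<Omega>\<^sub>1 = \<Sum>i. u\<^sub>i \<otimes> u'\<^sub>i\<close> and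
  \<open>\<Omega>\<^sub>2 = \<Sum>i. (-1)^p(u\<^sub>i) u'\<^sub>i \<otimes> u\<^sub>i\<close>, with \<open>x \<otimes> y\<close> or with the supersymmetric form
  \<open>\<theta>(x, y, z) = (-1)^(p(x)p(y) + p(z)) ([x, y], z)\<close>: up to scalars, the cubic term of the Dirac
  operator is \<open>\<theta>\<close> contracted with the cube of \<open>\<Omega>\<^sub>1 + \<Omega>\<^sub>2\<close>, whereas \<open>a\<close> uses \<open>\<Omega>\<^sub>2, \<Omega>\<^sub>2, \<Omega>\<^sub>1\<close> and
  its conjugate \<open>\<Omega>\<^sub>1, \<Omega>\<^sub>1, \<Omega>\<^sub>2\<close>. The pure cubes vanish by weights, the remaining six terms agree in
  threes, and invariance of \<open>\<theta>\<close> is the Jacobi identity.\<close>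

section \<open>Free algebras and bilinear extension\<close>

text \<open>The obstacle is that the quotients exist only through representatives.
  \<open>gen\<close> is linear only modulo the ideals and only between vectors of equal parity.
  Moreover the zero vector lies in both parts but has \<open>par\<close> 0, so a formula with parity
  signs is not literally multilinear. This is why linearity is demanded on each parity separately
  (\<open>hlin\<close>), why formal parities are carried as parameters, and why zero vectors are
  treated apart. The sign in the second tensor comes from supersymmetry: if u' is dual to u on the
  left, then (-1)^p(u) u is dual to u' on the left, and \<open>twist\<close> puts this sign into the
  vector. The six mixed terms agree in threes because the form and the wedge change by the same sign
  when two arguments are exchanged, so a contraction is symmetric in its three tensors. The
  resulting factor 3 turns -1/12 into -1/4. The pure cubes vanish because the nilradical is closed
  under the bracket and isotropic: a nonzero pairing needs opposite weights, whose values under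
  \<open>f\<close> cannot both be positive.\<close>

lemma lookup_scal [simp]: "Poly_Mapping.lookup (scal c a) k = c * Poly_Mapping.lookup a k"
  unfolding scal_def by (simp add: Poly_Mapping.map.rep_eq when_def)

interpretation scal: vector_space "scal :: complex \<Rightarrow> ('k \<Rightarrow>\<^sub>0 complex) \<Rightarrow> _"
  by unfold_locales (auto intro!: poly_mapping_eqI simp: lookup_add algebra_simps)

lemma scal_single [simp]: "scal c (Poly_Mapping.single k d) = Poly_Mapping.single k (c * d)"
  by (rule poly_mapping_eqI) (simp add: lookup_single when_def)

lemma scal_mult_left: "scal c a * b = scal c (a * b :: 'k::monoid_add \<Rightarrow>\<^sub>0 complex)"
  by (simp add: scal_def mult_map_scale_conv_mult mult.assoc)

lemma poly_mapping_sum_single: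
  "a = (\<Sum>k\<in>Poly_Mapping.keys a. Poly_Mapping.single k (Poly_Mapping.lookup a k))"
  by (rule poly_mapping_eqI) (auto simp: lookup_sum lookup_single when_def in_keys_iff)

text \<open>Reduces identities between additive expressions to monomials. Zero is covered by the
  monomial case with coefficient 0.\<close>

lemma poly_mapping_add_induct [case_names single add]:
  assumes single: "\<And>k c. P (Poly_Mapping.single k c)"
    and add: "\<And>a b. P a \<Longrightarrow> P b \<Longrightarrow> P (a + b)"
  shows "P (a :: 'k \<Rightarrow>\<^sub>0 complex)"
proof -
  have "P 0" using single[of undefined 0] by simp
  have "P (\<Sum>k\<in>K. Poly_Mapping.single k (Poly_Mapping.lookup a k))" if "finite K" for K
    using that by (induction K rule: finite_induct) (auto simp: \<open>P 0\<close> single add)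
  then show ?thesis
    using poly_mapping_sum_single[of a] by (metis finite_keys)
qed

lemma scal_mult_right: "a * scal c b = scal c (a * b :: 'k::monoid_add \<Rightarrow>\<^sub>0 complex)"
proof (induction a rule: poly_mapping_add_induct)
  case (single k d)
  show ?case
    by (induction b rule: poly_mapping_add_induct)
      (simp_all add: mult_single scal.scale_right_distrib algebra_simps)
next
  case (add a b)
  then show ?case by (simp add: algebra_simps scal.scale_right_distrib)
qed

text \<open>The supports in the definition vary with the arguments. Over common larger index sets,
  additivity is just distributivity of sums.\<close>

lemma bilinear_ext_superset:
  assumes "finite K" "Poly_Mapping.keys a \<subseteq> K" "finite M" "Poly_Mapping.keys b \<subseteq> M"
  shows "bilinear_ext \<phi> a b = (\<Sum>k\<in>K. \<Sum>l\<in>M.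
     scal (Poly_Mapping.lookup a k * Poly_Mapping.lookup b l) (\<phi> k l))"
  unfolding bilinear_ext_def
  using assms by (intro sum.mono_neutral_cong_left ballI) (auto simp: in_keys_iff intro!: sum.neutral)

lemma bilinear_ext_add_left: "bilinear_ext \<phi> (a + a') b = bilinear_ext \<phi> a b + bilinear_ext \<phi> a' b"
proof -
  let ?K = "Poly_Mapping.keys a \<union> Poly_Mapping.keys a'"
  have "Poly_Mapping.keys (a + a') \<subseteq> ?K" by (rule Poly_Mapping.keys_add)
  then show ?thesis
    by (simp add: bilinear_ext_superset[where K="?K" and M="Poly_Mapping.keys b"] sum.distrib
        lookup_add algebra_simps scal.scale_left_distrib)
qed

lemma bilinear_ext_add_right: "bilinear_ext \<phi> a (b + b') = bilinear_ext \<phi> a b + bilinear_ext \<phi> a b'"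
proof -
  let ?M = "Poly_Mapping.keys b \<union> Poly_Mapping.keys b'"
  have "Poly_Mapping.keys (b + b') \<subseteq> ?M" by (rule Poly_Mapping.keys_add)
  then show ?thesis
    by (simp add: bilinear_ext_superset[where K="Poly_Mapping.keys a" and M="?M"] sum.distrib
        lookup_add algebra_simps scal.scale_left_distrib)
qed

lemma keys_scal_subset: "Poly_Mapping.keys (scal c a) \<subseteq> Poly_Mapping.keys a"
  by (auto simp: in_keys_iff)

lemma bilinear_ext_scal_left: "bilinear_ext \<phi> (scal c a) b = scal c (bilinear_ext \<phi> a b)"
  by (simp add: bilinear_ext_superset[where K="Poly_Mapping.keys a" and M="Poly_Mapping.keys b"]
      keys_scal_subset scal.scale_sum_right mult.assoc)

lemma bilinear_ext_scal_right: "bilinear_ext \<phi> a (scal c b) = scal c (bilinear_ext \<phi> a b)"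
  by (simp add: bilinear_ext_superset[where K="Poly_Mapping.keys a" and M="Poly_Mapping.keys b"]
      keys_scal_subset scal.scale_sum_right mult_ac)

lemma bilinear_ext_single [simp]:
  "bilinear_ext \<phi> (Poly_Mapping.single k c) (Poly_Mapping.single l d) = scal (c * d) (\<phi> k l)"
  by (subst bilinear_ext_superset[where K="{k}" and M="{l}"]) auto

lemma linear_bilinear_ext_left: "Vector_Spaces.linear scal scal (\<lambda>a. bilinear_ext \<phi> a b)"
  by unfold_locales (simp_all add: bilinear_ext_add_left bilinear_ext_scal_left)

lemma linear_bilinear_ext_right: "Vector_Spaces.linear scal scal (bilinear_ext \<phi> a)"
  by unfold_locales (simp_all add: bilinear_ext_add_right bilinear_ext_scal_right)

text \<open>Extend a basis of \<open>K\<close> to the whole space, kill the part in \<open>K\<close>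
  and fix the rest. The map stays in the same space, so it replaces a quotient without a new
  type.\<close>

lemma (in vector_space) subspace_is_kernel:
  assumes "subspace K"
  obtains \<pi> where "Vector_Spaces.linear scale scale \<pi>" "\<And>x. \<pi> x = 0 \<longleftrightarrow> x \<in> K"
proof -
  interpret vs: vector_space_pair scale scale ..
  obtain B where B: "B \<subseteq> K" "independent B" "span B = K"
    by (metis assms basis_exists span_subspace)
  define C where "C = extend_basis B"
  have C: "B \<subseteq> C" "independent C" "span C = UNIV"
    using B(2) by (auto simp: C_def extend_basis_superset independent_extend_basis)
  obtain \<pi> where lin: "Vector_Spaces.linear scale scale \<pi>"
    and \<pi>: "\<And>b. b \<in> C \<Longrightarrow> \<pi> b = (if b \<in> B then 0 else b)"
    using vs.linear_independent_extend[OF C(2), of "\<lambda>b. if b \<in> B then 0 else b"] by auto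
  interpret \<pi>: Vector_Spaces.linear scale scale \<pi> by fact
  have "\<pi> x = 0" if "x \<in> K" for x
    using that B C \<pi> \<pi>.eq_0_on_span by (metis subset_iff)
  moreover have "x \<in> K" if "\<pi> x = 0" for x
  proof -
    have "x \<in> span (B \<union> (C - B))"
      using C by (simp add: Un_absorb1)
    then obtain y z where x: "x = y + z" and y: "y \<in> span B" and z: "z \<in> span (C - B)"
      unfolding span_Un by blast
    have "\<pi> y = 0"
      using \<open>\<And>x. x \<in> K \<Longrightarrow> \<pi> x = 0\<close> y B by simp
    moreover have "\<pi> z = z"
      using z
    proof (rule span_induct)
      show "subspace {z. \<pi> z = z}"
        by (auto simp: subspace_def \<pi>.add \<pi>.scale)
    qed (auto simp: \<pi>)
    ultimately have "z = 0" using that x by (simp add: \<pi>.add)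
    then show ?thesis using x y B by simp
  qed
  ultimately show ?thesis using that lin by blast
qed

section \<open>Homogeneous elements, invariant forms and weight spaces\<close>

lemma minus_one_power_mult_self: "(-1) ^ n * ((-1) ^ n :: complex) = 1"
  by (simp flip: power_add)

context lie_superalgebra
begin

lemma part_simps [simp]: "part L 0 = even_part L" "part L (Suc 0) = odd_part L"
  by (simp_all add: part_def)

lemma part_cong: "even (p + q) \<Longrightarrow> part L p = part L q"
  by (auto simp: part_def)

lemma subspace_even: "subspace (even_part L)" and subspace_odd: "subspace (odd_part L)"
  using subspace_part[of 0] subspace_part[of 1] by simp_all

lemma even_odd_unique:
  assumes "a \<in> even_part L" "a' \<in> even_part L" "b \<in> odd_part L" "b' \<in> odd_part L" "a + b = a' + b'"
  shows "a = a'" "b = b'"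
proof -
  have "a - a' = b' - b" using assms(5) by (simp add: algebra_simps)
  moreover have "a - a' \<in> even_part L" "b' - b \<in> odd_part L"
    using assms by (auto intro: subspace_diff subspace_even subspace_odd)
  ultimately have "a - a' = 0" "b' - b = 0" using even_Int_odd by (metis Int_iff singletonD)+
  then show "a = a'" "b = b'" by simp_all
qed

lemma par_0 [simp]: "par L 0 = 0"
  by (simp add: par_def)

lemma hom_part: "x \<in> hom_elems L V \<Longrightarrow> x \<in> part L (par L x)"
  using even_Int_odd by (auto simp: hom_elems_def par_def part_def)

lemma hom_elems_iff: "x \<in> hom_elems L V \<longleftrightarrow> x \<in> V \<and> x \<in> part L (par L x)"
  using hom_part[of x V] by (auto simp: hom_elems_def part_def[of L "par L x"] split: if_splits)

lemma part_hom: "x \<in> V \<Longrightarrow> x \<in> part L p \<Longrightarrow> x \<in> hom_elems L V"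
  by (auto simp: hom_elems_def part_def split: if_splits)

text \<open>Zero must be excluded, as it lies in every part while its \<open>par\<close> is 0. This
  is the source of the later case distinctions on zero vectors.\<close>

lemma par_part: "x \<in> part L p \<Longrightarrow> x \<noteq> 0 \<Longrightarrow> even (par L x + p)"
  using even_Int_odd by (auto simp: par_def part_def split: if_splits)

lemma bracket_zero [simp]: "bracket L 0 x = 0" "bracket L x 0 = 0"
  using bracket_scale_left[of 0 0 x] bracket_scale_right[of x 0 0] by simp_all

lemma jacobi_even:
  assumes "t \<in> even_part L"
  shows "bracket L t (bracket L x y) = bracket L (bracket L t x) y + bracket L x (bracket L t y)"
proof -
  obtain a b where "a \<in> even_part L" "b \<in> odd_part L" "x = a + b"
    using even_plus_odd by blast
  then show ?thesis
    using bracket_jacobi[of t 0 a 0 y] bracket_jacobi[of t 0 b 1 y] assms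
    by (simp add: bracket_add_left bracket_add_right)
qed

lemma skew_even:
  assumes "t \<in> even_part L"
  shows "bracket L x t = - bracket L t x"
proof -
  obtain a b where "a \<in> even_part L" "b \<in> odd_part L" "x = a + b"
    using even_plus_odd by blast
  then show ?thesis
    using bracket_skew[of a 0 t 0] bracket_skew[of b 1 t 0] assms
    by (simp add: bracket_add_left bracket_add_right)
qed

lemma bracket_span:
  assumes "\<And>x y. x \<in> F \<Longrightarrow> y \<in> G \<Longrightarrow> bracket L x y \<in> V" "subspace V" "x \<in> span F" "y \<in> span G"
  shows "bracket L x y \<in> V"
  using \<open>x \<in> span F\<close>
proof (rule span_induct)
  show "subspace {x. bracket L x y \<in> V}"
    using \<open>subspace V\<close> by (auto simp: subspace_def bracket_add_left bracket_scale_left)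
next
  fix x assume "x \<in> F"
  from \<open>y \<in> span G\<close> show "bracket L x y \<in> V"
  proof (rule span_induct)
    show "subspace {y. bracket L x y \<in> V}"
      using \<open>subspace V\<close> by (auto simp: subspace_def bracket_add_right bracket_scale_right)
  qed (use assms(1) \<open>x \<in> F\<close> in auto)
qed

definition graded :: "'g set \<Rightarrow> bool" where
  "graded V \<longleftrightarrow> (\<forall>x\<in>V. \<exists>a\<in>V \<inter> even_part L. \<exists>b\<in>V \<inter> odd_part L. x = a + b)"

lemma graded_span:
  assumes "\<And>x. x \<in> G \<Longrightarrow> \<exists>a\<in>span G \<inter> even_part L. \<exists>b\<in>span G \<inter> odd_part L. x = a + b"
  shows "graded (span G)"
  unfolding graded_def
proof
  fix x assume "x \<in> span G"
  then show "\<exists>a\<in>span G \<inter> even_part L. \<exists>b\<in>span G \<inter> odd_part L. x = a + b"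
  proof (rule span_induct)
    show "subspace {x. \<exists>a\<in>span G \<inter> even_part L. \<exists>b\<in>span G \<inter> odd_part L. x = a + b}"
      (is "subspace {x. ?Q x}")
    proof (rule subspaceI)
      show "0 \<in> {x. ?Q x}"
        using subspace_0[OF subspace_even] subspace_0[OF subspace_odd]
        by (auto intro!: bexI[of _ 0] span_zero)
    next
      fix x y assume "x \<in> {x. ?Q x}" "y \<in> {x. ?Q x}"
      then obtain a b a' b' where "a \<in> span G \<inter> even_part L" "b \<in> span G \<inter> odd_part L" "x = a + b"
        "a' \<in> span G \<inter> even_part L" "b' \<in> span G \<inter> odd_part L" "y = a' + b'"
        by auto
      then show "x + y \<in> {x. ?Q x}"
        by (intro CollectI bexI[of _ "a + a'"] bexI[of _ "b + b'"])
          (auto intro: span_add subspace_add subspace_even subspace_odd)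
    next
      fix c x assume "x \<in> {x. ?Q x}"
      then obtain a b where "a \<in> span G \<inter> even_part L" "b \<in> span G \<inter> odd_part L" "x = a + b"
        by auto
      then show "lscale L c x \<in> {x. ?Q x}"
        by (intro CollectI bexI[of _ "lscale L c a"] bexI[of _ "lscale L c b"])
          (auto intro: span_scale subspace_scale subspace_even subspace_odd simp: scale_right_distrib)
    qed
  qed (rule assms)
qed

end

section \<open>Invariant forms and dual bases\<close>

locale lie_superalgebra_form = lie_superalgebra L for L :: "('g::ab_group_add) lsa" +
  fixes B :: "'g \<Rightarrow> 'g \<Rightarrow> complex"
  assumes invariant_form: "invariant_form L B"
begin

lemma form_add_left: "B (x + y) z = B x z + B y z"
  and form_add_right: "B x (y + z) = B x y + B x z"
  and form_scale_left: "B (lscale L c x) y = c * B x y"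
  and form_scale_right: "B x (lscale L c y) = c * B x y"
  and form_invariant: "B (bracket L x y) z = B x (bracket L y z)"
  and form_sym: "x \<in> part L p \<Longrightarrow> y \<in> part L q \<Longrightarrow> B x y = (-1) ^ (p * q) * B y x"
  and form_even_odd: "x \<in> even_part L \<Longrightarrow> y \<in> odd_part L \<Longrightarrow> B x y = 0"
  using invariant_form unfolding invariant_form_def by blast+

lemma form_zero [simp]: "B 0 x = 0" "B x 0 = 0"
  using form_scale_left[of 0 0 x] form_scale_right[of x 0 0] by simp_all

lemma form_minus: "B (- x) y = - B x y" "B x (- y) = - B x y"
  using form_scale_left[of "-1" x y] form_scale_right[of x "-1" y] by simp_all

lemma form_sum_left: "B (\<Sum>i\<in>I. F i) y = (\<Sum>i\<in>I. B (F i) y)"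
  by (induction I rule: infinite_finite_induct) (simp_all add: form_add_left)

lemma form_sum_right: "B x (\<Sum>i\<in>I. F i) = (\<Sum>i\<in>I. B x (F i))"
  by (induction I rule: infinite_finite_induct) (simp_all add: form_add_right)

lemma form_part: "x \<in> part L p \<Longrightarrow> y \<in> part L q \<Longrightarrow> odd (p + q) \<Longrightarrow> B x y = 0"
  using form_sym[of x p y q] form_even_odd[of x y] form_even_odd[of y x]
  by (auto simp: part_def split: if_splits)

lemma form_span:
  assumes "\<And>x y. x \<in> F \<Longrightarrow> y \<in> G \<Longrightarrow> B x y = 0" "x \<in> span F" "y \<in> span G"
  shows "B x y = 0"
  using \<open>x \<in> span F\<close>
proof (rule span_induct)
  show "subspace {x. B x y = 0}"
    by (auto simp: subspace_def form_add_left form_scale_left)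
next
  fix x assume "x \<in> F"
  from \<open>y \<in> span G\<close> show "B x y = 0"
  proof (rule span_induct)
    show "subspace {y. B x y = 0}"
      by (auto simp: subspace_def form_add_right form_scale_right)
  qed (use assms(1) \<open>x \<in> F\<close> in auto)
qed

lemma indexed_basis_expand:
  assumes "indexed_basis L V n X" "x \<in> V"
  obtains c where "x = (\<Sum>i<n. lscale L (c i) (X i))"
proof -
  have "x \<in> span (X ` {..<n})" and inj: "inj_on X {..<n}"
    using assms by (auto simp: indexed_basis_def)
  then obtain c where "x = (\<Sum>v\<in>X ` {..<n}. lscale L (c v) v)"
    by (auto simp: span_finite)
  then show ?thesis
    using that[of "c \<circ> X"] by (simp add: sum.reindex[OF inj] comp_def)
qed

lemma dual_basis_expand_right:
  assumes "dual_basis L B V n X Y" "y \<in> V"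
  shows "y = (\<Sum>i<n. lscale L (B y (X i)) (Y i))"
proof -
  obtain c where c: "y = (\<Sum>i<n. lscale L (c i) (Y i))"
    using assms indexed_basis_expand unfolding dual_basis_def by blast
  have "B y (X j) = c j" if "j < n" for j
  proof -
    have "B y (X j) = (\<Sum>i<n. if i = j then c i else 0)"
      unfolding c form_sum_left form_scale_left
      using assms(1) that by (intro sum.cong) (auto simp: dual_basis_def)
    then show ?thesis using that by simp
  qed
  then show ?thesis using c by simp
qed

lemma dual_basis_expand_left:
  assumes "homogeneous_basis L V n X" "dual_basis L B V' n X Y" "x \<in> V"
  shows "x = (\<Sum>i<n. lscale L (B (Y i) x) (X i))"
proof -
  obtain c where c: "x = (\<Sum>i<n. lscale L (c i) (X i))"
    using assms indexed_basis_expand unfolding homogeneous_basis_def by blast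
  have "B (Y j) x = c j" if "j < n" for j
  proof -
    have "B (Y j) x = (\<Sum>i<n. if i = j then c i else 0)"
      unfolding c form_sum_right form_scale_right
      using assms(2) that by (intro sum.cong) (auto simp: dual_basis_def)
    then show ?thesis using that by simp
  qed
  then show ?thesis using c by simp
qed

text \<open>A dual basis is not assumed homogeneous, but duality forces it. The component of
  \<open>Y i\<close> of the wrong parity pairs to 0 with each \<open>X j\<close>: by parity if
  theirs differ, and otherwise because \<open>j\<close> is not \<open>i\<close> and the other
  component of \<open>Y i\<close> contributes nothing. Its expansion in \<open>Y\<close> is
  therefore 0.\<close>

lemma dual_basis_part:
  assumes X: "homogeneous_basis L V n X" and Y: "dual_basis L B V' n X Y" and "graded V'" and i: "i < n"
  shows "Y i \<in> part L (par L (X i))"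
proof -
  have XY: "B (Y i) (X j) = (if i = j then 1 else 0)" if "j < n" for j
    using Y i that by (auto simp: dual_basis_def)
  have Xpart: "X j \<in> part L (par L (X j))" if "j < n" for j
    using X that hom_part unfolding homogeneous_basis_def by blast
  have "Y i \<in> V'"
    using Y i by (auto simp: dual_basis_def indexed_basis_def intro: span_base)
  then obtain a b where a: "a \<in> V'" "a \<in> part L 0" and b: "b \<in> V'" "b \<in> part L 1" and ab: "Y i = a + b"
    using \<open>graded V'\<close> by (auto simp: graded_def)
  have zero: "z = 0" if z: "z \<in> V'" "z \<in> part L p" and y: "y \<in> part L q" "Y i = z + y"
    and odd: "odd (p + par L (X i))" "odd (p + q)" for z y p q
  proof -
    have "B z (X j) = 0" if "j < n" for j
    proof (cases "even (p + par L (X j))")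
      case True
      then have "B y (X j) = 0"
        using odd y by (intro form_part[OF y(1) Xpart[OF that]]) auto
      moreover have "i \<noteq> j" using True odd by auto
      ultimately show ?thesis using XY[OF that] y by (simp add: form_add_left)
    next
      case False
      then show ?thesis by (intro form_part[OF z(2) Xpart[OF that]])
    qed
    then show ?thesis using dual_basis_expand_right[OF Y z(1)] by simp
  qed
  show ?thesis
  proof (cases "even (par L (X i))")
    case True
    then show ?thesis using zero[OF b a(2)] ab a by (auto simp: part_def add.commute)
  next
    case False
    then show ?thesis using zero[OF a b(2)] ab b by (auto simp: part_def)
  qed
qed

lemma homogeneous_basis_graded:
  assumes "homogeneous_basis L V n X"
  shows "graded V"
proof -
  have "graded (span (X ` {..<n}))"
  proof (rule graded_span)
    fix x assume x: "x \<in> X ` {..<n}"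
    then have "x \<in> even_part L \<or> x \<in> odd_part L"
      using assms by (auto simp: homogeneous_basis_def hom_elems_def)
    moreover have "0 \<in> even_part L" "0 \<in> odd_part L" "0 \<in> span (X ` {..<n})"
      using even_Int_odd by (auto intro: span_zero)
    ultimately show "\<exists>a\<in>span (X ` {..<n}) \<inter> even_part L. \<exists>b\<in>span (X ` {..<n}) \<inter> odd_part L. x = a + b"
      using span_base[OF x] by force
  qed
  then show ?thesis using assms by (simp add: homogeneous_basis_def indexed_basis_def)
qed

end

section \<open>Weights, and the grading by \<open>f\<close>\<close>

locale parabolic = lie_superalgebra_form L B for L :: "('g::ab_group_add) lsa" and B +
  fixes h :: "'g set" and f :: "('g \<Rightarrow> complex) \<Rightarrow> int"
  assumes cartan: "cartan_subalgebra L h"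
    and additive: "additive_on_lattice L h f"
begin

lemma cartan_even: "t \<in> h \<Longrightarrow> t \<in> even_part L"
  and cartan_abelian: "t \<in> h \<Longrightarrow> t' \<in> h \<Longrightarrow> bracket L t t' = 0"
  using cartan unfolding cartan_subalgebra_def by blast+

lemma root_in_lattice: "\<alpha> \<in> roots L h \<Longrightarrow> \<alpha> \<in> root_lattice L h"
  using root_lattice.add[OF root_lattice.zero, of \<alpha>] by simp

lemma additive_add:
  "\<alpha> \<in> root_lattice L h \<Longrightarrow> \<beta> \<in> root_lattice L h \<Longrightarrow> f (\<lambda>t. \<alpha> t + \<beta> t) = f \<alpha> + f \<beta>"
  using additive unfolding additive_on_lattice_def by blast

lemma additive_zero: "f (\<lambda>t. 0) = 0"
  using additive_add[OF root_lattice.zero root_lattice.zero] by simp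

lemma subspace_nilrad: "subspace (nilrad L h f)" and subspace_opp_nilrad: "subspace (opp_nilrad L h f)"
  by (simp_all add: nilrad_def opp_nilrad_def)

lemma weight_space_homogeneous:
  assumes "a + b \<in> weight_space L h \<alpha>" "a \<in> even_part L" "b \<in> odd_part L"
  shows "a \<in> weight_space L h \<alpha>" "b \<in> weight_space L h \<alpha>"
proof -
  have "bracket L t a = lscale L (\<alpha> t) a \<and> bracket L t b = lscale L (\<alpha> t) b" if "t \<in> h" for t
  proof -
    have "bracket L t a + bracket L t b = lscale L (\<alpha> t) a + lscale L (\<alpha> t) b"
      using assms(1) that by (simp add: weight_space_def bracket_add_right scale_right_distrib)
    moreover have "bracket L t a \<in> even_part L" "bracket L t b \<in> odd_part L"
      using bracket_part[of t 0 a 0] bracket_part[of t 0 b 1] assms cartan_even[OF that] by simp_all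
    moreover have "lscale L (\<alpha> t) a \<in> even_part L" "lscale L (\<alpha> t) b \<in> odd_part L"
      using assms by (auto intro: subspace_scale subspace_even subspace_odd)
    ultimately show ?thesis using even_odd_unique by metis
  qed
  then show "a \<in> weight_space L h \<alpha>" "b \<in> weight_space L h \<alpha>" by (auto simp: weight_space_def)
qed

lemma graded_span_weight_spaces: "graded (span (\<Union>\<alpha>\<in>R. weight_space L h \<alpha>))"
proof (rule graded_span)
  fix x assume "x \<in> (\<Union>\<alpha>\<in>R. weight_space L h \<alpha>)"
  moreover obtain a b where "a \<in> even_part L" "b \<in> odd_part L" "x = a + b"
    using even_plus_odd by blast
  ultimately show "\<exists>a\<in>span (\<Union>\<alpha>\<in>R. weight_space L h \<alpha>) \<inter> even_part L.
      \<exists>b\<in>span (\<Union>\<alpha>\<in>R. weight_space L h \<alpha>) \<inter> odd_part L. x = a + b"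
    using weight_space_homogeneous by (blast intro: span_base)
qed

lemma bracket_weight_space:
  assumes "x \<in> weight_space L h \<alpha>" "y \<in> weight_space L h \<beta>"
  shows "bracket L x y \<in> weight_space L h (\<lambda>t. \<alpha> t + \<beta> t)"
  using assms cartan_even
  by (auto simp: weight_space_def jacobi_even bracket_scale_left bracket_scale_right scale_left_distrib)

text \<open>Put \<open>t\<close> in the middle of the invariance identity: on the left it acts on
  \<open>x\<close> by minus its weight, on the right on \<open>y\<close> by its weight.\<close>

lemma form_weight_space:
  assumes "x \<in> weight_space L h \<alpha>" "y \<in> weight_space L h \<beta>" "t \<in> h" "B x y \<noteq> 0"
  shows "\<alpha> t + \<beta> t = 0"
proof -
  have *: "- (\<alpha> t * B x y) = \<beta> t * B x y"
    using form_invariant[of x t y] assms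
    by (simp add: skew_even cartan_even weight_space_def form_minus form_scale_left form_scale_right)
  then have "(\<alpha> t + \<beta> t) * B x y = 0" by (simp add: distrib_right flip: *)
  then show ?thesis using assms(4) by simp
qed

lemma root_form_zero:
  assumes \<alpha>: "\<alpha> \<in> roots L h" and \<beta>: "\<beta> \<in> roots L h" and "f \<alpha> + f \<beta> \<noteq> 0"
    and "x \<in> weight_space L h \<alpha>" "y \<in> weight_space L h \<beta>"
  shows "B x y = 0"
proof (rule ccontr)
  assume "B x y \<noteq> 0"
  then have "\<alpha> t + \<beta> t = 0" if "t \<in> h" for t
    using form_weight_space assms that by blast
  \<comment> \<open>Functionals are extended by 0 outside \<open>h\<close>, so the sum is the zero
    function itself and \<open>f\<close> can be evaluated on it.\<close>
  moreover have "\<alpha> t + \<beta> t = 0" if "t \<notin> h" for t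
    using \<alpha> \<beta> that by (simp add: roots_def functional_on_def)
  ultimately have "(\<lambda>t. \<alpha> t + \<beta> t) = (\<lambda>t. 0)" by blast
  then show False
    using additive_add[of \<alpha> \<beta>] assms additive_zero root_in_lattice by simp
qed

lemma form_nilrad: "x \<in> nilrad L h f \<Longrightarrow> y \<in> nilrad L h f \<Longrightarrow> B x y = 0"
  unfolding nilrad_def by (erule (1) form_span[rotated]) (auto intro: root_form_zero)

text \<open>Meant for sums of roots, which need not be roots. Positivity of \<open>f\<close>
  excludes weight 0, so a nonzero \<open>x\<close> makes the weight a root, and the zero vector lies
  in the nilradical anyway.\<close>

lemma nilradI:
  assumes "\<alpha> \<in> root_lattice L h" "functional_on L h \<alpha>" "f \<alpha> > 0" "x \<in> weight_space L h \<alpha>"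
  shows "x \<in> nilrad L h f"
proof (cases "x = 0")
  case False
  have "\<exists>t. \<alpha> t \<noteq> 0"
    using assms(3) additive_zero by (metis ext less_irrefl)
  with False assms have "\<alpha> \<in> roots L h" by (auto simp: roots_def)
  with assms show ?thesis unfolding nilrad_def by (auto intro!: span_base)
qed (use subspace_nilrad subspace_0 in auto)

lemma functional_on_add:
  "functional_on L h \<alpha> \<Longrightarrow> functional_on L h \<beta> \<Longrightarrow> functional_on L h (\<lambda>t. \<alpha> t + \<beta> t)"
  by (auto simp: functional_on_def algebra_simps)

text \<open>The first weight ranges over the lattice with \<open>f\<close> nonnegative, so that
  \<open>h\<close> (weight 0), the Levi roots and the nilradical roots are all covered at
  once.\<close>

lemma bracket_nilradI:
  assumes "\<alpha> \<in> root_lattice L h" "functional_on L h \<alpha>" "f \<alpha> \<ge> 0" "x \<in> weight_space L h \<alpha>"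
    and "\<beta> \<in> roots L h" "f \<beta> > 0" "y \<in> weight_space L h \<beta>"
  shows "bracket L x y \<in> nilrad L h f"
proof (rule nilradI)
  show "(\<lambda>t. \<alpha> t + \<beta> t) \<in> root_lattice L h" using assms by (intro root_lattice.add)
  show "functional_on L h (\<lambda>t. \<alpha> t + \<beta> t)" using assms by (auto intro: functional_on_add simp: roots_def)
  show "f (\<lambda>t. \<alpha> t + \<beta> t) > 0" using additive_add[of \<alpha> \<beta>] assms root_in_lattice by simp
  show "bracket L x y \<in> weight_space L h (\<lambda>t. \<alpha> t + \<beta> t)" using assms bracket_weight_space by blast
qed

lemma root_functional: "\<alpha> \<in> roots L h \<Longrightarrow> functional_on L h \<alpha>"
  by (simp add: roots_def)

lemma bracket_nilrad:
  assumes "x \<in> nilrad L h f" "y \<in> nilrad L h f"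
  shows "bracket L x y \<in> nilrad L h f"
  using _ subspace_nilrad assms[unfolded nilrad_def]
  by (rule bracket_span) (auto intro: bracket_nilradI root_in_lattice root_functional)

lemma bracket_levi_nilrad:
  assumes "x \<in> levi L h f" "y \<in> nilrad L h f"
  shows "bracket L x y \<in> nilrad L h f"
  using _ subspace_nilrad assms[unfolded levi_def nilrad_def]
proof (rule bracket_span)
  fix x y
  assume x: "x \<in> h \<union> (\<Union>\<alpha>\<in>{\<alpha> \<in> roots L h. f \<alpha> = 0}. weight_space L h \<alpha>)"
    and "y \<in> (\<Union>\<alpha>\<in>{\<alpha> \<in> roots L h. f \<alpha> > 0}. weight_space L h \<alpha>)"
  then obtain \<beta> where \<beta>: "\<beta> \<in> roots L h" "f \<beta> > 0" "y \<in> weight_space L h \<beta>" by auto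
  from x show "bracket L x y \<in> nilrad L h f"
  proof
    assume "x \<in> h"
    then have "x \<in> weight_space L h (\<lambda>t. 0)" by (auto simp: weight_space_def cartan_abelian)
    then show ?thesis
      using \<beta> additive_zero by (intro bracket_nilradI[OF root_lattice.zero]) (auto simp: functional_on_def)
  next
    assume "x \<in> (\<Union>\<alpha>\<in>{\<alpha> \<in> roots L h. f \<alpha> = 0}. weight_space L h \<alpha>)"
    then obtain \<alpha> where "\<alpha> \<in> roots L h" "f \<alpha> = 0" "x \<in> weight_space L h \<alpha>" by auto
    then show ?thesis
      using \<beta> by (intro bracket_nilradI[of \<alpha> x \<beta> y] root_in_lattice root_functional) auto
  qed
qed

lemma form_bracket_nilrad:
  "x \<in> nilrad L h f \<Longrightarrow> y \<in> nilrad L h f \<Longrightarrow> z \<in> nilrad L h f \<Longrightarrow> B (bracket L x y) z = 0"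
  using bracket_nilrad form_nilrad by blast

text \<open>Negating \<open>f\<close> keeps the Levi subalgebra and exchanges the two nilradicals,
  so each fact about \<open>nilrad\<close> yields one about \<open>opp_nilrad\<close>.\<close>

lemma parabolic_uminus: "parabolic L B h (\<lambda>\<alpha>. - f \<alpha>)"
  using additive by unfold_locales (auto simp: cartan additive_on_lattice_def)

lemma nilrad_uminus: "nilrad L h (\<lambda>\<alpha>. - f \<alpha>) = opp_nilrad L h f"
  and levi_uminus: "levi L h (\<lambda>\<alpha>. - f \<alpha>) = levi L h f"
  by (simp_all add: nilrad_def opp_nilrad_def levi_def)

lemmas form_opp_nilrad = parabolic.form_nilrad[OF parabolic_uminus, unfolded nilrad_uminus]
  and form_bracket_opp_nilrad =
    parabolic.form_bracket_nilrad[OF parabolic_uminus, unfolded nilrad_uminus]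
  and bracket_levi_opp_nilrad =
    parabolic.bracket_levi_nilrad[OF parabolic_uminus, unfolded nilrad_uminus levi_uminus]

lemma graded_opp_nilrad: "graded (opp_nilrad L h f)"
  unfolding opp_nilrad_def by (rule graded_span_weight_spaces)

end

section \<open>Ideals, parity signs and supercommutators\<close>

lemma word_par_simps [simp]:
  "word_par L 0 = 0" "word_par L (v + w) = word_par L v + word_par L w" "word_par L (Word [x]) = par L x"
  by (simp_all add: word_par_def zero_word_def plus_word_def)

lemma one_eq_single: "(1 :: 'k::zero \<Rightarrow>\<^sub>0 complex) = Poly_Mapping.single 0 1"
  by simp

lemma free_on_simps [simp, intro]:
  "x \<in> H \<Longrightarrow> gen x \<in> free_on H"
  "1 \<in> free_on H"
  "a \<in> free_on H \<Longrightarrow> scal c a \<in> free_on H"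
  unfolding one_eq_single
  by (auto simp: free_on_def gen_def zero_word_def in_keys_iff lookup_single when_def split: if_splits)

lemma free_on_mult [simp, intro]:
  assumes "a \<in> free_on H" "b \<in> free_on H"
  shows "a * b \<in> free_on H"
  unfolding free_on_def
proof (intro CollectI ballI)
  fix w assume "w \<in> Poly_Mapping.keys (a * b)"
  then obtain v v' where "w = v + v'" "v \<in> Poly_Mapping.keys a" "v' \<in> Poly_Mapping.keys b"
    using keys_mult[of a b] by auto
  then show "set (letters w) \<subseteq> H"
    using assms by (auto simp: free_on_def plus_word_def)
qed

lemma ideal_mult_left: "x \<in> two_sided_ideal H R \<Longrightarrow> a \<in> free_on H \<Longrightarrow> a * x \<in> two_sided_ideal H R"
  using two_sided_ideal.mult[of x H R a 1] by simp

lemma ideal_mult_right: "x \<in> two_sided_ideal H R \<Longrightarrow> a \<in> free_on H \<Longrightarrow> x * a \<in> two_sided_ideal H R"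
  using two_sided_ideal.mult[of x H R 1 a] by simp

lemma subspace_two_sided_ideal: "scal.subspace (two_sided_ideal H R)"
proof (rule scal.subspaceI)
  fix c x assume "x \<in> two_sided_ideal H R"
  then have "scal c 1 * x \<in> two_sided_ideal H R"
    by (intro ideal_mult_left) auto
  then show "scal c x \<in> two_sided_ideal H R" by (simp add: scal_mult_left)
qed (auto intro: two_sided_ideal.intros)

section \<open>Tensors and their supercommutators\<close>

lemma tensor_add_left: "tensor (a + a') b = tensor a b + tensor a' b"
  and tensor_add_right: "tensor a (b + b') = tensor a b + tensor a b'"
  and tensor_scal_left: "tensor (scal c a) b = scal c (tensor a b)"
  and tensor_scal_right: "tensor a (scal c b) = scal c (tensor a b)"
  by (simp_all add: tensor_def bilinear_ext_add_left bilinear_ext_add_right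
      bilinear_ext_scal_left bilinear_ext_scal_right)

lemma linear_tensor_left: "Vector_Spaces.linear scal scal (\<lambda>a. tensor a b)"
  and linear_tensor_right: "Vector_Spaces.linear scal scal (tensor a)"
  unfolding tensor_def by (rule linear_bilinear_ext_left linear_bilinear_ext_right)+

lemma tensor_diff_left: "tensor (a - a') b = tensor a b - tensor a' b"
proof -
  interpret Vector_Spaces.linear scal scal "\<lambda>a. tensor a b" by (rule linear_tensor_left)
  show ?thesis by (rule diff)
qed

lemma tensor_diff_right: "tensor a (b - b') = tensor a b - tensor a b'"
proof -
  interpret Vector_Spaces.linear scal scal "tensor a" by (rule linear_tensor_right)
  show ?thesis by (rule diff)
qed

lemma tensor_single [simp]:
  "tensor (Poly_Mapping.single v c) (Poly_Mapping.single w d) = Poly_Mapping.single (v, w) (c * d)"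
  by (simp add: tensor_def)

lemma subspace_tensor_ideal:
  assumes "scal.subspace I" "scal.subspace J"
  shows "scal.subspace (tensor_ideal H I H' J)"
proof (rule scal.subspaceI)
  fix c x assume "x \<in> tensor_ideal H I H' J"
  then show "scal c x \<in> tensor_ideal H I H' J"
  proof induction
    case (left a b)
    then show ?case
      using assms tensor_ideal.left[of "scal c a" I b H' H J]
      by (simp add: tensor_scal_left scal.subspace_scale)
  next
    case (right a b)
    then show ?case
      using assms tensor_ideal.right[of a H "scal c b" J I H']
      by (simp add: tensor_scal_right scal.subspace_scale)
  qed (auto intro: tensor_ideal.intros simp: scal.scale_right_distrib)
qed (auto intro: tensor_ideal.intros)

text \<open>As \<open>[n, w] = n w - w \<sigma>(n)\<close> for a word \<open>w\<close> and the power \<open>\<sigma>\<close> of the parity automorphism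
  given by the parity of \<open>w\<close>, the representative \<open>\<nu> X\<close> need not be homogeneous in the free
  algebra.\<close>

definition parity_sign :: "('g::ab_group_add) lsa \<Rightarrow> nat \<Rightarrow> 'g free \<Rightarrow> 'g free" where
  "parity_sign L p a = Poly_Mapping.mapp (\<lambda>w c. (-1) ^ (p * word_par L w) * c) a"

lemma lookup_parity_sign [simp]:
  "Poly_Mapping.lookup (parity_sign L p a) w = (-1) ^ (p * word_par L w) * Poly_Mapping.lookup a w"
  by (simp add: parity_sign_def lookup_mapp when_def in_keys_iff)

lemma parity_sign_add [simp]: "parity_sign L p (a + b) = parity_sign L p a + parity_sign L p b"
  and parity_sign_diff [simp]: "parity_sign L p (a - b) = parity_sign L p a - parity_sign L p b"
  and parity_sign_scal [simp]: "parity_sign L p (scal c a) = scal c (parity_sign L p a)"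
  and parity_sign_zero [simp]: "parity_sign L p 0 = 0"
  and parity_sign_0 [simp]: "parity_sign L 0 a = a"
  and parity_sign_parity_sign [simp]: "parity_sign L p (parity_sign L q a) = parity_sign L (p + q) a"
  by (rule poly_mapping_eqI; simp add: lookup_add lookup_minus algebra_simps power_add)+

lemma parity_sign_single [simp]:
  "parity_sign L p (Poly_Mapping.single w c) = Poly_Mapping.single w ((-1) ^ (p * word_par L w) * c)"
  by (rule poly_mapping_eqI) (simp add: lookup_single when_def)

lemma parity_sign_gen [simp]: "parity_sign L p (gen x) = scal ((-1) ^ (p * par L x)) (gen x)"
  by (simp add: gen_def)

lemma parity_sign_one [simp]: "parity_sign L p 1 = 1"
  unfolding one_eq_single by (simp del: single_one)

lemma parity_sign_mult [simp]: "parity_sign L p (a * b) = parity_sign L p a * parity_sign L p b"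
proof (induction a rule: poly_mapping_add_induct)
  case (single v c)
  show ?case
    by (induction b rule: poly_mapping_add_induct)
      (simp_all add: mult_single algebra_simps power_add)
qed (simp add: algebra_simps)

lemma parity_sign_free_on [simp, intro]: "a \<in> free_on H \<Longrightarrow> parity_sign L p a \<in> free_on H"
  by (simp add: free_on_def in_keys_iff)

lemma supercomm_single:
  "supercomm L n (Poly_Mapping.single w 1) =
     n * Poly_Mapping.single w 1 - Poly_Mapping.single w 1 * parity_sign L (word_par L w) n"
proof (induction n rule: poly_mapping_add_induct)
  case (single v c)
  then show ?case
    by (simp add: supercomm_def mult_single scal.scale_right_diff_distrib mult.commute)
next
  case (add a b)
  then show ?case
    by (simp add: supercomm_def bilinear_ext_add_left distrib_left distrib_right)
qed

lemma tensor_mult_single [simp]: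
  "tensor_mult L (Poly_Mapping.single x c) (Poly_Mapping.single y d) =
     Poly_Mapping.single (fst x + fst y, snd x + snd y) (c * d * (-1) ^ (word_par L (snd x) * word_par L (fst y)))"
  by (simp add: tensor_mult_def case_prod_beta)

lemma tensor_supercomm_add_left:
    "tensor_supercomm L (a + a') b = tensor_supercomm L a b + tensor_supercomm L a' b"
  by (simp add: tensor_supercomm_def bilinear_ext_add_left)

lemma linear_tensor_supercomm: "Vector_Spaces.linear scal scal (tensor_supercomm L a)"
  unfolding tensor_supercomm_def by (rule linear_bilinear_ext_right)

text \<open>Moving \<open>n\<close> past \<open>v\<close> costs a Koszul sign on each homogeneous
  component of \<open>n\<close>, and moving it past both factors costs the sign of their joint
  parity. These are the two applications of \<open>parity_sign\<close>.\<close>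

lemma tensor_supercomm_right_single:
  "tensor_supercomm L (tensor 1 n) (tensor (Poly_Mapping.single v 1) (Poly_Mapping.single w 1)) =
     tensor (Poly_Mapping.single v 1) (parity_sign L (word_par L v) n * Poly_Mapping.single w 1
       - Poly_Mapping.single w 1 * parity_sign L (word_par L v + word_par L w) n)"
  unfolding one_eq_single
proof (induction n rule: poly_mapping_add_induct)
  case (single u c)
  then show ?case
    by (simp del: single_one add: tensor_supercomm_def mult_single scal.scale_right_diff_distrib
        tensor_diff_right mult.commute)
next
  case (add a b)
  then show ?case
    by (simp del: single_one add: tensor_add_right tensor_supercomm_add_left distrib_left distrib_right
      tensor_diff_right)
qed

lemma tensor_supercomm_gen_left:
  "tensor_supercomm L (tensor (gen x) 1) (tensor (gen u) (Poly_Mapping.single w 1)) =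
     tensor (gen x * gen u - scal ((-1) ^ (par L x * par L u)) (gen u * gen x)) (Poly_Mapping.single w 1)"
proof -
  \<comment> \<open>The sign for exchanging \<open>x\<close> with \<open>w\<close> occurs once in
    the supercommutator and once in the tensor product, so only that for \<open>x\<close> and
    \<open>u\<close> survives.\<close>
  have "(-1) ^ (par L x * (par L u + word_par L w)) * (-1) ^ (word_par L w * par L x)
      = ((-1) ^ (par L x * par L u) :: complex)"
    by (simp add: minus_one_power_iff)
  then show ?thesis
    unfolding one_eq_single gen_def
    by (simp del: single_one add: tensor_supercomm_def mult_single tensor_diff_left)
qed

lemma tensor_supercomm_gen_one:
  "tensor_supercomm L (tensor (gen x) 1) (tensor 1 (Poly_Mapping.single w 1)) = 0"
proof -
  have "(-1) ^ (par L x * word_par L w) * (-1) ^ (word_par L w * par L x) = (1 :: complex)"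
    by (simp add: minus_one_power_iff)
  then show ?thesis
    unfolding one_eq_single gen_def
    by (simp del: single_one add: tensor_supercomm_def mult_single)
qed

lemma prod_inversions_3:
  fixes g :: "nat \<Rightarrow> nat \<Rightarrow> complex" and \<pi> :: "nat \<Rightarrow> nat"
  shows "(\<Prod>(i, j)\<in>{(i, j). i < j \<and> j < 3 \<and> \<pi> j < \<pi> i}. g i j) =
    (if \<pi> 1 < \<pi> 0 then g 0 1 else 1) * (if \<pi> 2 < \<pi> 0 then g 0 2 else 1)
      * (if \<pi> 2 < \<pi> 1 then g 1 2 else 1)"
proof -
  have "{(i, j). i < j \<and> j < 3 \<and> \<pi> j < \<pi> i} = {x \<in> {(0, 1), (0, 2), (1, 2)}. \<pi> (snd x) < \<pi> (fst x)}"
    by (auto simp: numeral_3_eq_3 less_Suc_eq)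
  then show ?thesis by (simp only: prod.inter_filter finite.intros) simp
qed

text \<open>The six permutations appear as composed transpositions because they are generated by
  inserting 1 and then 2 into the permutations of {0}.\<close>

lemma sum_permutations_3:
  "(\<Sum>\<pi> | \<pi> permutes {..<3::nat}. F \<pi>) =
     F id + F (Transposition.transpose 1 0) + F (Transposition.transpose 2 1)
     + F (Transposition.transpose 2 1 \<circ> Transposition.transpose 1 0)
     + F (Transposition.transpose 2 0)
     + F (Transposition.transpose 2 0 \<circ> Transposition.transpose 1 0)"
proof -
  have 3: "{..<3} = {2, 1, 0 :: nat}" by auto
  show ?thesis
    unfolding 3
    by (simp add: sum_over_permutations_insert permutes_sing add.assoc del: One_nat_def)
qed

lemma quant_wedge_3:
  "quant_wedge L [x, y, z] = (let s = (\<lambda>a b. (-1) ^ (par L a * par L b)) in scal (1 / 6)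
     (gen x * gen y * gen z
      - scal (s x y) (gen y * gen x * gen z)
      - scal (s y z) (gen x * gen z * gen y)
      + scal (s x y * s x z) (gen y * gen z * gen x)
      + scal (s x z * s y z) (gen z * gen x * gen y)
      - scal (s x y * s x z * s y z) (gen z * gen y * gen x)))"
proof -
  have n: "length [x, y, z] = 3" and f: "fact 3 = (6 :: complex)" and l: "[0..<3] = [0, 1, 2 :: nat]"
    by (simp_all add: fact_numeral upt_rec)
  have "quant_wedge L [x, y, z] = scal (1 / 6) (\<Sum>\<pi> | \<pi> permutes {..<3}.
     scal (\<Prod>(i, j)\<in>{(i, j). i < j \<and> j < 3 \<and> \<pi> j < \<pi> i}.
             - ((-1) ^ (par L ([x, y, z] ! \<pi> i) * par L ([x, y, z] ! \<pi> j))))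
          (gen ([x, y, z] ! \<pi> 0) * gen ([x, y, z] ! \<pi> 1) * gen ([x, y, z] ! \<pi> 2)))"
    unfolding quant_wedge_def Let_def n f l by (simp add: mult.assoc)
  then show ?thesis
    by (simp only: prod_inversions_3 sum_permutations_3)
      (simp add: transpose_def Let_def mult_ac)
qed

section \<open>Congruence modulo the defining ideal\<close>

lemma (in lie_superalgebra_form) subspace_uea_ideal: "scal.subspace (uea_ideal L)"
  and subspace_clifford_ideal: "scal.subspace (clifford_ideal L B S)"
  by (simp_all only: uea_ideal_def clifford_ideal_def Let_def subspace_two_sided_ideal)

locale clifford_setting = lie_superalgebra_form L B for L :: "('g::ab_group_add) lsa" and B +
  fixes S :: "'g set"
  assumes subspace_S: "subspace S"
begin

lemma linear_relators_clifford:
  "r \<in> linear_relators L (hom_elems L S) \<Longrightarrow> r \<in> clifford_ideal L B S"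
  by (simp add: clifford_ideal_def Let_def two_sided_ideal.relator)

lemma clifford_mult_left: "x \<in> clifford_ideal L B S \<Longrightarrow> a \<in> free_on (hom_elems L S) \<Longrightarrow> a * x \<in> clifford_ideal L B S"
  and clifford_mult_right: "x \<in> clifford_ideal L B S \<Longrightarrow> a \<in> free_on (hom_elems L S) \<Longrightarrow> x * a \<in> clifford_ideal L B S"
  by (simp_all only: clifford_ideal_def Let_def ideal_mult_left ideal_mult_right)

lemma zero_in_hom_elems [simp]: "0 \<in> hom_elems L S"
  using subspace_0[OF subspace_S] subspace_0[OF subspace_even] by (auto simp: hom_elems_def)

lemma clifford_add:
  "x \<in> S \<inter> part L p \<Longrightarrow> y \<in> S \<inter> part L p \<Longrightarrow> gen (x + y) - gen x - gen y \<in> clifford_ideal L B S"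
  by (rule linear_relators_clifford) (auto simp: linear_relators_def intro: part_hom)

lemma clifford_scale: "x \<in> hom_elems L S \<Longrightarrow> gen (lscale L c x) - scal c (gen x) \<in> clifford_ideal L B S"
  by (rule linear_relators_clifford) (auto simp: linear_relators_def)

lemma clifford_gen_zero: "gen 0 \<in> clifford_ideal L B S"
  using clifford_scale[of 0 0] by simp

lemma uea_add:
  assumes "x \<in> part L p" "y \<in> part L p"
  shows "gen (x + y) - gen x - gen y \<in> uea_ideal L"
proof -
  have "x \<in> hom_elems L UNIV" "y \<in> hom_elems L UNIV"
    using assms part_hom by blast+
  with assms show ?thesis
    unfolding uea_ideal_def Let_def linear_relators_def by (blast intro: two_sided_ideal.relator)
qed

lemma uea_scale: "x \<in> hom_elems L UNIV \<Longrightarrow> gen (lscale L c x) - scal c (gen x) \<in> uea_ideal L"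
  unfolding uea_ideal_def Let_def
  by (rule two_sided_ideal.relator) (auto simp: linear_relators_def)

lemma uea_bracket:
  "x \<in> hom_elems L UNIV \<Longrightarrow> y \<in> hom_elems L UNIV \<Longrightarrow>
    gen x * gen y - scal ((-1) ^ (par L x * par L y)) (gen y * gen x) - gen (bracket L x y) \<in> uea_ideal L"
  unfolding uea_ideal_def Let_def
  by (rule two_sided_ideal.relator) auto

lemma part_add: "x \<in> part L p \<Longrightarrow> y \<in> part L p \<Longrightarrow> x + y \<in> part L p"
  and part_scale: "x \<in> part L p \<Longrightarrow> lscale L c x \<in> part L p"
  using subspace_part subspace_add subspace_scale by blast+

text \<open>Only a congruence: \<open>gen 0\<close> is a nonzero word of parity 0 in the free
  algebra, although 0 also lies in the odd part. It does lie in the ideal.\<close>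

lemma parity_sign_gen_clifford:
  assumes "z \<in> part L q"
  shows "parity_sign L p (gen z) - scal ((-1) ^ (p * q)) (gen z) \<in> clifford_ideal L B S"
proof (cases "z = 0")
  case True
  then show ?thesis
    using clifford_gen_zero subspace_clifford_ideal
    by (simp add: scal.subspace_diff scal.subspace_scale)
next
  case False
  then have "even (par L z) = even q" using par_part[OF assms] by simp
  then show ?thesis
    using subspace_clifford_ideal by (simp add: minus_one_power_iff scal.subspace_0)
qed

text \<open>The parity automorphism preserves the ideal since it maps each relator to a multiple of
  itself, up to elements of the ideal.\<close>

lemma parity_sign_clifford:
  assumes "a \<in> clifford_ideal L B S"
  shows "parity_sign L p a \<in> clifford_ideal L B S"
proof -
  let ?J = "clifford_ideal L B S"
  note J = scal.subspace_diff[OF subspace_clifford_ideal[of S]] scal.subspace_add[OF subspace_clifford_ideal[of S]]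
    scal.subspace_scale[OF subspace_clifford_ideal[of S]]
  have add: "parity_sign L p (gen (x + y) - gen x - gen y) \<in> ?J"
    if "x \<in> S \<inter> part L q" "y \<in> S \<inter> part L q" for x y q
  proof -
    \<comment> \<open>If one of the three vectors is zero, its word can have the wrong parity. The
      defects \<open>?d\<close> absorb this and lie in the ideal.\<close>
    let ?d = "\<lambda>z. parity_sign L p (gen z) - scal ((-1) ^ (p * q)) (gen z)"
    have "?d (x + y) - ?d x - ?d y + scal ((-1) ^ (p * q)) (gen (x + y) - gen x - gen y) \<in> ?J"
      using that by (intro J parity_sign_gen_clifford clifford_add) (auto intro: part_add)
    then show ?thesis by (simp add: scal.scale_right_diff_distrib algebra_simps)
  qed
  have scale: "parity_sign L p (gen (lscale L c x) - scal c (gen x)) \<in> ?J" if "x \<in> hom_elems L S" for c x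
  proof -
    define q where "q = par L x"
    let ?d = "\<lambda>z. parity_sign L p (gen z) - scal ((-1) ^ (p * q)) (gen z)"
    have "?d (lscale L c x) - scal c (?d x) + scal ((-1) ^ (p * q)) (gen (lscale L c x) - scal c (gen x)) \<in> ?J"
      using that by (intro J parity_sign_gen_clifford clifford_scale) (auto simp: q_def intro: part_scale hom_part)
    then show ?thesis
      by (simp add: scal.scale_right_diff_distrib algebra_simps del: parity_sign_gen)
  qed
  have cliff: "parity_sign L p (gen v * gen w + scal ((-1) ^ (par L v * par L w)) (gen w * gen v)
      - scal (2 * B v w) 1) \<in> ?J" (is "parity_sign L p ?r \<in> _")
    if "v \<in> hom_elems L S" "w \<in> hom_elems L S" for v w
  proof -
    have "?r \<in> ?J"
      unfolding clifford_ideal_def Let_def using that by (auto intro!: two_sided_ideal.relator)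
    moreover have "parity_sign L p ?r = scal ((-1) ^ (p * (par L v + par L w))) ?r"
    proof (cases "even (par L v + par L w)")
      case True
      then show ?thesis by (simp add: minus_one_power_iff scal_mult_left scal_mult_right)
    next
      case False
      \<comment> \<open>The constant term is even, so an odd relator is homogeneous only because the
        form vanishes between different parities.\<close>
      then have "B v w = 0" using that hom_part form_part by blast
      then show ?thesis
        by (simp add: power_add distrib_left scal.scale_right_distrib scal_mult_left scal_mult_right mult.commute)
    qed
    ultimately show ?thesis using J(3) by simp
  qed
  obtain R where R: "?J = two_sided_ideal (hom_elems L S) R"
    and sign: "\<And>r. r \<in> R \<Longrightarrow> parity_sign L p r \<in> ?J"
  proof
    let ?C = "{gen v * gen w + scal ((-1) ^ (par L v * par L w)) (gen w * gen v) - scal (2 * B v w) 1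
       | v w. v \<in> hom_elems L S \<and> w \<in> hom_elems L S}"
    show "?J = two_sided_ideal (hom_elems L S) (linear_relators L (hom_elems L S) \<union> ?C)"
      by (simp only: clifford_ideal_def Let_def)
    fix r assume "r \<in> linear_relators L (hom_elems L S) \<union> ?C"
    then consider (add) x y q where "r = gen (x + y) - gen x - gen y" "x \<in> S \<inter> part L q" "y \<in> S \<inter> part L q"
      | (scale) c x where "r = gen (lscale L c x) - scal c (gen x)" "x \<in> hom_elems L S"
      | (cliff) v w where "r = gen v * gen w + scal ((-1) ^ (par L v * par L w)) (gen w * gen v)
          - scal (2 * B v w) 1" "v \<in> hom_elems L S" "w \<in> hom_elems L S"
      unfolding linear_relators_def hom_elems_def by blast
    then show "parity_sign L p r \<in> ?J"
      by cases (simp_all only: add scale cliff)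
  qed
  from assms[unfolded R] have "parity_sign L p a \<in> two_sided_ideal (hom_elems L S) R"
  proof induction
    case (relator r)
    then show ?case using sign by (simp only: R)
  next
    case (mult x a b)
    then show ?case by (auto intro: two_sided_ideal.mult)
  qed (auto intro: two_sided_ideal.intros)
  then show ?thesis by (simp only: R)
qed

text \<open>A linear map with kernel \<open>uc_ideal L B S\<close> turns congruences in \<open>U(g) \<otimes> C(s)\<close> into
  equations.\<close>

definition proj :: "'g free2 \<Rightarrow> 'g free2" where
  "proj = (SOME \<pi>. Vector_Spaces.linear scal scal \<pi> \<and> (\<forall>x. \<pi> x = 0 \<longleftrightarrow> x \<in> uc_ideal L B S))"

lemma linear_proj: "Vector_Spaces.linear scal scal proj"
  and proj_eq_0_iff: "proj x = 0 \<longleftrightarrow> x \<in> uc_ideal L B S"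
proof -
  have "scal.subspace (uc_ideal L B S)"
    unfolding uc_ideal_def
    by (intro subspace_tensor_ideal subspace_uea_ideal subspace_clifford_ideal)
  then obtain \<pi> :: "'g free2 \<Rightarrow> 'g free2"
    where "Vector_Spaces.linear scal scal \<pi> \<and> (\<forall>x. \<pi> x = 0 \<longleftrightarrow> x \<in> uc_ideal L B S)"
    by (rule scal.subspace_is_kernel) blast
  then have "Vector_Spaces.linear scal scal proj \<and> (\<forall>x. proj x = 0 \<longleftrightarrow> x \<in> uc_ideal L B S)"
    unfolding proj_def by (rule someI[where P = "\<lambda>\<pi>. Vector_Spaces.linear scal scal \<pi> \<and> (\<forall>x. \<pi> x = 0 \<longleftrightarrow> x \<in> uc_ideal L B S)"])
  then show "Vector_Spaces.linear scal scal proj" "proj x = 0 \<longleftrightarrow> x \<in> uc_ideal L B S" by auto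
qed

sublocale proj: Vector_Spaces.linear scal scal proj
  by (rule linear_proj)

lemma uc_eq_iff: "uc_eq L B S x y \<longleftrightarrow> proj x = proj y"
  using proj_eq_0_iff[of "x - y"] by (simp add: uc_eq_def proj.diff)

lemma proj_tensor_left:
  "a - a' \<in> uea_ideal L \<Longrightarrow> b \<in> free_on (hom_elems L S) \<Longrightarrow> proj (tensor a b) = proj (tensor a' b)"
  unfolding uc_eq_iff[symmetric] uc_eq_def uc_ideal_def tensor_diff_left[symmetric]
  by (rule tensor_ideal.left)

lemma proj_tensor_right:
  "b - b' \<in> clifford_ideal L B S \<Longrightarrow> a \<in> free_on (hom_elems L UNIV) \<Longrightarrow> proj (tensor a b) = proj (tensor a b')"
  unfolding uc_eq_iff[symmetric] uc_eq_def uc_ideal_def tensor_diff_right[symmetric]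
  by (rule tensor_ideal.right)

end

section \<open>Maps that are linear on homogeneous elements\<close>

context clifford_setting
begin

text \<open>The relators make \<open>gen\<close> additive only within one parity, and parity signs
  are constant only there. Nothing is asked of mixed sums, whose generators do not occur in the
  algebra.\<close>

definition hlin :: "('g \<Rightarrow> ('k \<Rightarrow>\<^sub>0 complex)) \<Rightarrow> bool" where
  "hlin \<phi> \<longleftrightarrow> (\<forall>p. \<forall>x\<in>S \<inter> part L p.
     (\<forall>y\<in>S \<inter> part L p. \<phi> (x + y) = \<phi> x + \<phi> y) \<and> (\<forall>c. \<phi> (lscale L c x) = scal c (\<phi> x)))"

lemma hlinI:
  assumes "\<And>p x y. x \<in> S \<Longrightarrow> y \<in> S \<Longrightarrow> x \<in> part L p \<Longrightarrow> y \<in> part L p \<Longrightarrow> \<phi> (x + y) = \<phi> x + \<phi> y"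
    and "\<And>p x c. x \<in> S \<Longrightarrow> x \<in> part L p \<Longrightarrow> \<phi> (lscale L c x) = scal c (\<phi> x)"
  shows "hlin \<phi>"
  using assms unfolding hlin_def by blast

lemma hlin_add: "hlin \<phi> \<Longrightarrow> x \<in> S \<Longrightarrow> y \<in> S \<Longrightarrow> x \<in> part L p \<Longrightarrow> y \<in> part L p \<Longrightarrow> \<phi> (x + y) = \<phi> x + \<phi> y"
  and hlin_scale: "hlin \<phi> \<Longrightarrow> x \<in> S \<Longrightarrow> x \<in> part L p \<Longrightarrow> \<phi> (lscale L c x) = scal c (\<phi> x)"
  unfolding hlin_def by blast+

lemma hlin_zero: "hlin \<phi> \<Longrightarrow> \<phi> 0 = 0"
  using hlin_scale[of \<phi> 0 0 0] subspace_0[OF subspace_S] subspace_0[OF subspace_even] by simp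

lemma hlin_sum:
  assumes "hlin \<phi>" "\<And>i. i \<in> A \<Longrightarrow> x i \<in> S \<inter> part L p"
  shows "\<phi> (\<Sum>i\<in>A. x i) = (\<Sum>i\<in>A. \<phi> (x i))"
  using assms(2)
proof (induction A rule: infinite_finite_induct)
  case (insert i A)
  then have "(\<Sum>i\<in>A. x i) \<in> S" "(\<Sum>i\<in>A. x i) \<in> part L p"
    by (auto intro!: subspace_sum subspace_S subspace_part)
  with insert show ?case
    using hlin_add[OF assms(1), of "x i" "\<Sum>i\<in>A. x i" p] by simp
qed (simp_all add: hlin_zero[OF assms(1)])

text \<open>The coefficients will be values of the even form, which vanish at the wrong parity.
  Hence the parity condition on \<open>e\<close> is imposed for nonzero \<open>c\<close>
  only.\<close>

lemma lincomb_part: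
  assumes "e \<in> hom_elems L S" "c \<noteq> 0 \<Longrightarrow> even (par L e + p)"
  shows "lscale L c e \<in> S \<inter> part L p"
proof (cases "c = 0")
  case True
  then show ?thesis by (simp add: subspace_0[OF subspace_S] subspace_0[OF subspace_part])
next
  case False
  then have "part L (par L e) = part L p" using assms part_cong by blast
  then show ?thesis using assms(1) subspace_S by (auto simp: hom_elems_iff subspace_scale part_scale)
qed

lemma hlin_lincomb:
  assumes "hlin \<phi>" "\<And>i. i \<in> A \<Longrightarrow> e i \<in> hom_elems L S"
    and "\<And>i. i \<in> A \<Longrightarrow> c i \<noteq> 0 \<Longrightarrow> even (par L (e i) + p)"
  shows "\<phi> (\<Sum>i\<in>A. lscale L (c i) (e i)) = (\<Sum>i\<in>A. scal (c i) (\<phi> (e i)))"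
proof -
  have "\<phi> (\<Sum>i\<in>A. lscale L (c i) (e i)) = (\<Sum>i\<in>A. \<phi> (lscale L (c i) (e i)))"
    using assms by (intro hlin_sum lincomb_part) auto
  also have "\<dots> = (\<Sum>i\<in>A. scal (c i) (\<phi> (e i)))"
    using assms(2) by (intro sum.cong refl hlin_scale[OF assms(1)]) (auto simp: hom_elems_iff)
  finally show ?thesis .
qed

lemma hlin_plus: "hlin \<phi> \<Longrightarrow> hlin \<psi> \<Longrightarrow> hlin (\<lambda>x. \<phi> x + \<psi> x)"
  by (rule hlinI) (simp_all add: hlin_add[of \<phi>] hlin_add[of \<psi>] hlin_scale[of \<phi>]
      hlin_scale[of \<psi>] scal.scale_right_distrib)

lemma hlin_scal: "hlin \<phi> \<Longrightarrow> hlin (\<lambda>x. scal c (\<phi> x))"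
  by (rule hlinI) (simp_all add: hlin_add[of \<phi>] hlin_scale[of \<phi>] scal.scale_right_distrib mult.commute)

lemma hlin_minus: "hlin \<phi> \<Longrightarrow> hlin \<psi> \<Longrightarrow> hlin (\<lambda>x. \<phi> x - \<psi> x)"
  using hlin_plus[of \<phi> "\<lambda>x. scal (-1) (\<psi> x)"] hlin_scal[of \<psi> "-1"] by simp

lemmas hlin_comb = hlin_plus hlin_minus hlin_scal

text \<open>As \<open>hlin\<close> is tested on one parity at a time, the comparison map may depend
  on that parity. In this way parity signs can first be frozen to constants.\<close>

lemma hlin_cong:
  assumes "\<And>p. hlin (\<phi> p)" "\<And>x p. x \<in> S \<Longrightarrow> x \<in> part L p \<Longrightarrow> \<psi> x = \<phi> p x"
  shows "hlin \<psi>"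
proof (rule hlinI)
  fix p x y assume xy: "x \<in> S" "y \<in> S" "x \<in> part L p" "y \<in> part L p"
  then have "x + y \<in> S" "x + y \<in> part L p" by (simp_all add: subspace_S subspace_add part_add)
  then show "\<psi> (x + y) = \<psi> x + \<psi> y"
    using hlin_add[OF assms(1)[of p] xy] xy by (metis assms(2))
next
  fix p x c assume x: "x \<in> S" "x \<in> part L p"
  then have "lscale L c x \<in> S" "lscale L c x \<in> part L p" by (simp_all add: subspace_S subspace_scale part_scale)
  then show "\<psi> (lscale L c x) = scal c (\<psi> x)"
    using hlin_scale[OF assms(1)[of p] x] x by (metis assms(2))
qed

text \<open>On nonzero vectors of fixed parity the factor is constant. At 0, where
  \<open>par\<close> may jump, \<open>\<phi>\<close> vanishes.\<close>

lemma hlin_par: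
  assumes "hlin \<phi>"
  shows "hlin (\<lambda>x. scal (\<sigma> (par L x)) (\<phi> x))"
proof -
  have *: "scal (\<sigma> (par L x)) (\<phi> x) = scal (\<sigma> (p mod 2)) (\<phi> x)" if "x \<in> S" "x \<in> part L p" for x p
  proof (cases "x = 0")
    case False
    then have "even (par L x + p)" by (rule par_part[OF that(2)])
    moreover have "par L x < 2" by (simp add: par_def)
    ultimately have "par L x = p mod 2" by presburger
    then show ?thesis by simp
  qed (simp add: hlin_zero[OF assms])
  show ?thesis
    by (rule hlin_cong[OF hlin_scal[OF assms] *]) auto
qed

lemma hlin_form: "hlin (\<lambda>x. scal (B (bracket L x y) z) v)" "hlin (\<lambda>x. scal (B (bracket L y x) z) v)"
  "hlin (\<lambda>x. scal (B z x) v)"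
  by (intro hlinI; simp add: bracket_add_left bracket_add_right bracket_scale_left bracket_scale_right
      form_add_left form_add_right form_scale_left form_scale_right scal.scale_left_distrib)+

section \<open>Images of tensors and cubic wedges in the quotient\<close>

definition P :: "'g \<Rightarrow> 'g \<Rightarrow> 'g free2" where
  "P x y = proj (tensor (gen x) (gen y))"

definition M :: "'g \<Rightarrow> 'g \<Rightarrow> 'g \<Rightarrow> 'g free2" where
  "M x y z = proj (tensor 1 (gen x * gen y * gen z))"

definition W :: "'g \<Rightarrow> 'g \<Rightarrow> 'g \<Rightarrow> 'g free2" where
  "W x y z = proj (tensor 1 (quant_wedge L [x, y, z]))"

text \<open>Super-antisymmetrization with parities as parameters. With constant signs it is linear
  in each vector by linearity of \<open>M\<close>, and \<open>W_part\<close> then carries this over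
  to \<open>W\<close>.\<close>

definition W_par :: "nat \<Rightarrow> nat \<Rightarrow> nat \<Rightarrow> 'g \<Rightarrow> 'g \<Rightarrow> 'g \<Rightarrow> 'g free2" where
  "W_par p q r x y z = scal (1 / 6)
     (M x y z - scal ((-1) ^ (p * q)) (M y x z) - scal ((-1) ^ (q * r)) (M x z y)
      + scal ((-1) ^ (p * q) * (-1) ^ (p * r)) (M y z x) + scal ((-1) ^ (p * r) * (-1) ^ (q * r)) (M z x y)
      - scal ((-1) ^ (p * q) * (-1) ^ (p * r) * (-1) ^ (q * r)) (M z y x))"

lemma W_eq_W_par: "W x y z = W_par (par L x) (par L y) (par L z) x y z"
  by (simp add: W_def W_par_def M_def quant_wedge_3 Let_def tensor_add_right tensor_diff_right
      tensor_scal_right proj.add proj.diff proj.scale)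

lemma hom_elems_UNIV: "x \<in> hom_elems L V \<Longrightarrow> x \<in> hom_elems L UNIV"
  by (auto simp: hom_elems_def)

lemma hlin_P:
  assumes "y \<in> hom_elems L S"
  shows "hlin (\<lambda>x. P x y)" "hlin (\<lambda>x. P y x)"
proof -
  have "proj (tensor (gen (x + x')) (gen y)) = proj (tensor (gen x + gen x') (gen y))"
    if "x \<in> part L p" "x' \<in> part L p" for x x' p
    using uea_add[OF that] assms by (intro proj_tensor_left) (auto simp: algebra_simps)
  moreover have "proj (tensor (gen (lscale L c x)) (gen y)) = proj (tensor (scal c (gen x)) (gen y))"
    if "x \<in> part L p" for x c p
    using uea_scale[OF part_hom[OF _ that]] assms by (intro proj_tensor_left) auto
  ultimately show "hlin (\<lambda>x. P x y)"
    by (intro hlinI) (simp_all add: P_def tensor_add_left tensor_scal_left proj.add proj.scale)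
  have "proj (tensor (gen y) (gen (x + x'))) = proj (tensor (gen y) (gen x + gen x'))"
    if "x \<in> S" "x' \<in> S" "x \<in> part L p" "x' \<in> part L p" for x x' p
    using clifford_add[of x p x'] that assms
    by (intro proj_tensor_right) (auto simp: algebra_simps intro: hom_elems_UNIV)
  moreover have "proj (tensor (gen y) (gen (lscale L c x))) = proj (tensor (gen y) (scal c (gen x)))"
    if "x \<in> S" "x \<in> part L p" for x c p
    using clifford_scale[OF part_hom[OF that]] assms
    by (intro proj_tensor_right) (auto intro: hom_elems_UNIV)
  ultimately show "hlin (\<lambda>x. P y x)"
    by (intro hlinI) (simp_all add: P_def tensor_add_right tensor_scal_right proj.add proj.scale)
qed

lemma hlin_Clifford_mult:
  assumes "a \<in> free_on (hom_elems L S)" "b \<in> free_on (hom_elems L S)"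
  shows "hlin (\<lambda>x. proj (tensor 1 (a * gen x * b)))"
proof -
  have "proj (tensor 1 (a * gen (x + x') * b)) = proj (tensor 1 (a * (gen x + gen x') * b))"
    if "x \<in> S" "x' \<in> S" "x \<in> part L p" "x' \<in> part L p" for x x' p
    using clifford_mult_right[OF clifford_mult_left[OF clifford_add[of x p x'] assms(1)] assms(2)] that
    by (intro proj_tensor_right) (auto simp: algebra_simps)
  moreover have "proj (tensor 1 (a * gen (lscale L c x) * b)) = proj (tensor 1 (a * scal c (gen x) * b))"
    if "x \<in> S" "x \<in> part L p" for x c p
    using clifford_mult_right[OF clifford_mult_left[OF clifford_scale[OF part_hom[OF that]] assms(1)] assms(2)]
    by (intro proj_tensor_right) (auto simp: algebra_simps)
  ultimately show ?thesis
    by (intro hlinI) (simp_all add: tensor_add_right tensor_scal_right proj.add proj.scale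
        distrib_left distrib_right scal_mult_left scal_mult_right)
qed

lemma hlin_M:
  assumes "y \<in> hom_elems L S" "z \<in> hom_elems L S"
  shows "hlin (\<lambda>x. M x y z)" "hlin (\<lambda>x. M y x z)" "hlin (\<lambda>x. M y z x)"
  using hlin_Clifford_mult[of 1 "gen y * gen z"] hlin_Clifford_mult[of "gen y" "gen z"]
    hlin_Clifford_mult[of "gen y * gen z" 1] assms
  by (simp_all add: M_def[abs_def] mult.assoc)

lemma hlin_W_par:
  assumes "y \<in> hom_elems L S" "z \<in> hom_elems L S"
  shows "hlin (\<lambda>x. W_par p q r x y z)" "hlin (\<lambda>x. W_par p q r y x z)" "hlin (\<lambda>x. W_par p q r y z x)"
  unfolding W_par_def by (intro hlin_comb hlin_M assms)+

lemma W_part: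
  assumes "x \<in> S \<inter> part L p" "y \<in> S \<inter> part L q" "z \<in> S \<inter> part L r"
  shows "W x y z = W_par p q r x y z"
proof -
  have H: "x \<in> hom_elems L S" "y \<in> hom_elems L S" "z \<in> hom_elems L S"
    using assms part_hom by blast+
  show ?thesis
  proof (cases "x = 0 \<or> y = 0 \<or> z = 0")
    case True
    \<comment> \<open>With a zero argument the formal parities may disagree with \<open>par\<close>,
      but both sides vanish.\<close>
    then have "W_par p' q' r' x y z = 0" for p' q' r'
      using hlin_W_par[OF H(2,3), THEN hlin_zero] hlin_W_par[OF H(1,3), THEN hlin_zero]
        hlin_W_par[OF H(1,2), THEN hlin_zero] by metis
    then show ?thesis by (simp add: W_eq_W_par)
  next
    case False
    then have "even (par L x) = even p" "even (par L y) = even q" "even (par L z) = even r"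
      using assms par_part by (metis even_add IntE)+
    then show ?thesis by (simp add: W_eq_W_par W_par_def minus_one_power_iff)
  qed
qed

lemma hlin_W:
  assumes "y \<in> hom_elems L S" "z \<in> hom_elems L S"
  shows "hlin (\<lambda>x. W x y z)" "hlin (\<lambda>x. W y x z)" "hlin (\<lambda>x. W y z x)"
proof -
  have yz: "y \<in> S \<inter> part L (par L y)" "z \<in> S \<inter> part L (par L z)"
    using assms by (auto simp: hom_elems_iff)
  show "hlin (\<lambda>x. W x y z)"
    by (rule hlin_cong[OF hlin_W_par(1)[OF assms]]) (rule W_part[OF _ yz], simp)
  show "hlin (\<lambda>x. W y x z)"
    by (rule hlin_cong[OF hlin_W_par(2)[OF assms]]) (rule W_part[OF yz(1) _ yz(2)], simp)
  show "hlin (\<lambda>x. W y z x)"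
    by (rule hlin_cong[OF hlin_W_par(3)[OF assms]]) (rule W_part[OF yz], simp)
qed

text \<open>Already true in the free algebra, without Clifford relations, since each permutation
  carries its Koszul sign.\<close>

lemma quant_wedge_swap:
  "quant_wedge L [y, x, z] = scal (- ((-1) ^ (par L x * par L y))) (quant_wedge L [x, y, z])"
  "quant_wedge L [x, z, y] = scal (- ((-1) ^ (par L y * par L z))) (quant_wedge L [x, y, z])"
  unfolding quant_wedge_3 Let_def scal.scale_left_commute[of _ "1 / 6"]
  by (rule arg_cong[where f = "scal (1 / 6)"];
      cases "even (par L x)"; cases "even (par L y)"; cases "even (par L z)";
      simp add: minus_one_power_iff)+

lemma W_swap:
  "W y x z = scal (- ((-1) ^ (par L x * par L y))) (W x y z)"
  "W x z y = scal (- ((-1) ^ (par L y * par L z))) (W x y z)"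
  by (simp_all only: W_def quant_wedge_swap(1)[of y x z] quant_wedge_swap(2)[of x z y] tensor_scal_right proj.scale)

end

section \<open>The action of a Levi element\<close>

text \<open>\<open>n\<close> stands for the value of \<open>\<nu>\<close> at \<open>X\<close>. Its
  effect on the Clifford factor is described by supercommutators with generators.\<close>

locale levi_action = clifford_setting L B S for L :: "('g::ab_group_add) lsa" and B S +
  fixes X :: 'g and n :: "'g free"
  assumes X_hom: "X \<in> hom_elems L UNIV"
    and stable: "v \<in> S \<Longrightarrow> bracket L X v \<in> S"
    and action: "v \<in> hom_elems L S \<Longrightarrow>
      supercomm L n (gen v) - gen (bracket L X v) \<in> clifford_ideal L B S"
begin

lemma bracket_X_part: "v \<in> part L p \<Longrightarrow> bracket L X v \<in> part L (par L X + p)"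
  using bracket_part hom_part[OF X_hom] by blast

lemma bracket_X_hom: "v \<in> hom_elems L S \<Longrightarrow> bracket L X v \<in> hom_elems L S"
  using bracket_X_part stable part_hom by (metis hom_elems_iff)

text \<open>Apply the parity automorphism to \<open>action\<close> and cancel the sign of
  \<open>gen v\<close>. The shift \<open>p\<close> is the parity of the factors that
  \<open>n\<close> has already passed, so these congruences telescope along a word.\<close>

lemma action_parity_sign:
  assumes "v \<in> hom_elems L S"
  shows "(parity_sign L p n * gen v - gen v * parity_sign L (p + par L v) n)
    - scal ((-1) ^ (p * par L X)) (gen (bracket L X v)) \<in> clifford_ideal L B S"
proof -
  let ?w = "bracket L X v" and ?J = "clifford_ideal L B S" and ?s = "(-1) ^ (p * par L v) :: complex"
  note J = scal.subspace_add[OF subspace_clifford_ideal[of S]] scal.subspace_scale[OF subspace_clifford_ideal[of S]]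
  have "n * gen v - gen v * parity_sign L (par L v) n - gen ?w \<in> ?J"
    using action[OF assms] by (simp add: gen_def supercomm_single)
  then have "parity_sign L p (n * gen v - gen v * parity_sign L (par L v) n - gen ?w) \<in> ?J"
    by (rule parity_sign_clifford)
  moreover have "parity_sign L p (gen ?w) - scal ((-1) ^ (p * (par L X + par L v))) (gen ?w) \<in> ?J"
    using assms by (intro parity_sign_gen_clifford bracket_X_part) (simp add: hom_elems_iff)
  ultimately have "scal ?s (parity_sign L p (n * gen v - gen v * parity_sign L (par L v) n - gen ?w)
      + (parity_sign L p (gen ?w) - scal ((-1) ^ (p * (par L X + par L v))) (gen ?w))) \<in> ?J"
    by (intro J)
  also have "?s * (-1) ^ (p * (par L X + par L v)) = (-1) ^ (p * par L X)"
    by (simp add: minus_one_power_iff)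
  then have "scal ?s (parity_sign L p (n * gen v - gen v * parity_sign L (par L v) n - gen ?w)
      + (parity_sign L p (gen ?w) - scal ((-1) ^ (p * (par L X + par L v))) (gen ?w))) =
    (parity_sign L p n * gen v - gen v * parity_sign L (p + par L v) n)
    - scal ((-1) ^ (p * par L X)) (gen ?w)"
    by (simp add: scal.scale_right_diff_distrib scal_mult_left scal_mult_right minus_one_power_mult_self)
  finally show ?thesis .
qed

text \<open>The operator whose zeros are the invariant elements. Its argument is a representative,
  and only its value is reduced modulo the ideal.\<close>

definition \<delta> :: "'g free2 \<Rightarrow> 'g free2" where
  "\<delta> a = proj (tensor_supercomm L (tensor (gen X) 1 + tensor 1 n) a)"

sublocale \<delta>: Vector_Spaces.linear scal scal \<delta>
  using Vector_Spaces.linear_compose[OF linear_tensor_supercomm linear_proj]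
  unfolding \<delta>_def[abs_def] by (simp add: comp_def)

lemma \<delta>_P:
  assumes "u \<in> hom_elems L S" "y \<in> hom_elems L S"
  shows "\<delta> (tensor (gen u) (gen y)) =
    P (bracket L X u) y + scal ((-1) ^ (par L X * par L u)) (P u (bracket L X y))"
proof -
  have "\<delta> (tensor (gen u) (gen y)) =
      proj (tensor (gen X * gen u - scal ((-1) ^ (par L X * par L u)) (gen u * gen X)) (gen y))
      + proj (tensor (gen u) (parity_sign L (par L u) n * gen y - gen y * parity_sign L (par L u + par L y) n))"
    using tensor_supercomm_gen_left[of L X u "Word [y]"] tensor_supercomm_right_single[of L n "Word [u]" "Word [y]"]
    by (simp add: \<delta>_def tensor_supercomm_add_left proj.add gen_def)
  also have "proj (tensor (gen X * gen u - scal ((-1) ^ (par L X * par L u)) (gen u * gen X)) (gen y)) =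
      P (bracket L X u) y"
    unfolding P_def using assms X_hom by (intro proj_tensor_left uea_bracket) (auto intro: hom_elems_UNIV)
  also have "proj (tensor (gen u) (parity_sign L (par L u) n * gen y - gen y * parity_sign L (par L u + par L y) n)) =
      proj (tensor (gen u) (scal ((-1) ^ (par L u * par L X)) (gen (bracket L X y))))"
    using assms by (intro proj_tensor_right action_parity_sign) (auto intro: hom_elems_UNIV)
  finally show ?thesis
    by (simp add: P_def tensor_scal_right proj.scale mult.commute)
qed

lemma \<delta>_M:
  assumes "x \<in> hom_elems L S" "y \<in> hom_elems L S" "z \<in> hom_elems L S"
  shows "\<delta> (tensor 1 (gen x * gen y * gen z)) = M (bracket L X x) y z
    + scal ((-1) ^ (par L X * par L x)) (M x (bracket L X y) z)
    + scal ((-1) ^ (par L X * (par L x + par L y))) (M x y (bracket L X z))"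
proof -
  let ?J = "clifford_ideal L B S" and ?\<sigma> = "\<lambda>p. parity_sign L p n"
  define d where "d p v = (?\<sigma> p * gen v - gen v * ?\<sigma> (p + par L v))
      - scal ((-1) ^ (p * par L X)) (gen (bracket L X v))" for p v
  have d: "d p v \<in> ?J" if "v \<in> hom_elems L S" for p v
    unfolding d_def using that by (rule action_parity_sign)
  have word: "gen x * gen y * gen z = Poly_Mapping.single (Word [x, y, z]) 1"
    by (simp add: gen_def mult_single plus_word_def)
  have par: "word_par L (Word [x, y, z]) = par L x + par L y + par L z"
    by (simp add: word_par_def)
  have "\<delta> (tensor 1 (gen x * gen y * gen z)) =
      proj (tensor 1 (n * (gen x * gen y * gen z) - gen x * gen y * gen z * ?\<sigma> (par L x + par L y + par L z)))"
    using tensor_supercomm_right_single[of L n 0 "Word [x, y, z]"]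
    by (simp add: \<delta>_def tensor_supercomm_add_left proj.add word tensor_supercomm_gen_one par)
  also have "\<dots> = proj (tensor 1 (gen (bracket L X x) * gen y * gen z
      + scal ((-1) ^ (par L x * par L X)) (gen x * gen (bracket L X y) * gen z)
      + scal ((-1) ^ ((par L x + par L y) * par L X)) (gen x * gen y * gen (bracket L X z))))"
  proof (rule proj_tensor_right)
    \<comment> \<open>A telescoping sum: the second term of each \<open>d\<close> cancels the first
      term of the next, since the shifts are the parities of the letters passed.\<close>
    have "d 0 x * (gen y * gen z) + gen x * d (par L x) y * gen z
        + gen x * gen y * d (par L x + par L y) z \<in> ?J"
      using assms
      by (intro scal.subspace_add[OF subspace_clifford_ideal] clifford_mult_left[OF d] clifford_mult_right
          clifford_mult_right[OF d]) (auto intro: d)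
    also have "d 0 x * (gen y * gen z) + gen x * d (par L x) y * gen z
        + gen x * gen y * d (par L x + par L y) z =
      n * (gen x * gen y * gen z) - gen x * gen y * gen z * ?\<sigma> (par L x + par L y + par L z)
      - (gen (bracket L X x) * gen y * gen z
      + scal ((-1) ^ (par L x * par L X)) (gen x * gen (bracket L X y) * gen z)
      + scal ((-1) ^ ((par L x + par L y) * par L X)) (gen x * gen y * gen (bracket L X z)))"
      unfolding d_def
      by (simp add: left_diff_distrib right_diff_distrib mult.assoc scal_mult_left scal_mult_right)
    finally show "n * (gen x * gen y * gen z) - gen x * gen y * gen z * ?\<sigma> (par L x + par L y + par L z)
      - (gen (bracket L X x) * gen y * gen z
      + scal ((-1) ^ (par L x * par L X)) (gen x * gen (bracket L X y) * gen z)
      + scal ((-1) ^ ((par L x + par L y) * par L X)) (gen x * gen y * gen (bracket L X z))) \<in> ?J" .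
  qed simp
  finally show ?thesis
    by (simp add: M_def tensor_add_right tensor_scal_right proj.add proj.scale mult.commute)
qed

text \<open>Apply \<open>\<delta>_M\<close> to all six orderings. The right-hand sides are expanded
  through \<open>W_par\<close>, because a bracket with \<open>X\<close> has the formal parity of a
  sum even where it is zero.\<close>

lemma \<delta>_W:
  assumes "x \<in> hom_elems L S" "y \<in> hom_elems L S" "z \<in> hom_elems L S"
  shows "\<delta> (tensor 1 (quant_wedge L [x, y, z])) = W (bracket L X x) y z
    + scal ((-1) ^ (par L X * par L x)) (W x (bracket L X y) z)
    + scal ((-1) ^ (par L X * (par L x + par L y))) (W x y (bracket L X z))"
proof -
  let ?\<xi> = "par L X" and ?p = "par L x" and ?q = "par L y" and ?r = "par L z"
  have S: "x \<in> S \<inter> part L ?p" "y \<in> S \<inter> part L ?q" "z \<in> S \<inter> part L ?r"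
    using assms by (auto simp: hom_elems_iff)
  then have XS: "bracket L X x \<in> S \<inter> part L (?\<xi> + ?p)" "bracket L X y \<in> S \<inter> part L (?\<xi> + ?q)"
    "bracket L X z \<in> S \<inter> part L (?\<xi> + ?r)"
    by (auto intro: stable bracket_X_part)
  have W: "W (bracket L X x) y z = W_par (?\<xi> + ?p) ?q ?r (bracket L X x) y z"
    "W x (bracket L X y) z = W_par ?p (?\<xi> + ?q) ?r x (bracket L X y) z"
    "W x y (bracket L X z) = W_par ?p ?q (?\<xi> + ?r) x y (bracket L X z)"
    using S XS by (auto intro!: W_part)
  show ?thesis
    unfolding W W_par_def quant_wedge_3 Let_def tensor_scal_right tensor_add_right tensor_diff_right
      \<delta>.add \<delta>.diff \<delta>.scale \<delta>_M[OF assms] \<delta>_M[OF assms(2,1,3)] \<delta>_M[OF assms(1,3,2)]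
      \<delta>_M[OF assms(2,3,1)] \<delta>_M[OF assms(3,1,2)] \<delta>_M[OF assms(3,2,1)]
      scal.scale_left_commute[of _ "1 / 6"] scal.scale_right_distrib[of "1 / 6", symmetric]
    by (rule arg_cong[where f = "scal (1 / 6)"];
        cases "even ?\<xi>"; cases "even ?p"; cases "even ?q"; cases "even ?r";
        simp add: minus_one_power_iff scal.scale_right_distrib)
qed

end

section \<open>Dual pairs and invariant cubic sums\<close>

context clifford_setting
begin

definition hbilin :: "('g \<Rightarrow> 'g \<Rightarrow> ('k \<Rightarrow>\<^sub>0 complex)) \<Rightarrow> bool" where
  "hbilin \<psi> \<longleftrightarrow> (\<forall>y\<in>hom_elems L S. hlin (\<lambda>x. \<psi> x y) \<and> hlin (\<lambda>x. \<psi> y x))"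

lemma hbilinI:
  "(\<And>y. y \<in> hom_elems L S \<Longrightarrow> hlin (\<lambda>x. \<psi> x y)) \<Longrightarrow> (\<And>y. y \<in> hom_elems L S \<Longrightarrow> hlin (\<lambda>x. \<psi> y x)) \<Longrightarrow> hbilin \<psi>"
  by (simp add: hbilin_def)

lemma hbilinD:
  "hbilin \<psi> \<Longrightarrow> y \<in> hom_elems L S \<Longrightarrow> hlin (\<lambda>x. \<psi> x y)"
  "hbilin \<psi> \<Longrightarrow> y \<in> hom_elems L S \<Longrightarrow> hlin (\<lambda>x. \<psi> y x)"
  by (simp_all add: hbilin_def)

lemma hbilin_P: "hbilin P"
  by (intro hbilinI hlin_P)

text \<open>Duality is recorded by the two expansion formulas, which say that the sum of the e_i
  tensor e'_i is the canonical tensor of the pairing of \<open>V'\<close> with \<open>V\<close>. The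
  form has the \<open>V'\<close> argument on the left.\<close>

definition dual_pair :: "'g set \<Rightarrow> 'g set \<Rightarrow> nat \<Rightarrow> (nat \<Rightarrow> 'g) \<Rightarrow> (nat \<Rightarrow> 'g) \<Rightarrow> bool" where
  "dual_pair V V' n e e' \<longleftrightarrow> V \<subseteq> S \<and> V' \<subseteq> S \<and>
     (\<forall>i<n. e i \<in> hom_elems L V \<and> e' i \<in> hom_elems L V' \<and> par L (e' i) = par L (e i)) \<and>
     (\<forall>x\<in>V. x = (\<Sum>i<n. lscale L (B (e' i) x) (e i))) \<and>
     (\<forall>x\<in>V'. x = (\<Sum>i<n. lscale L (B x (e i)) (e' i)))"

lemma dual_pairD:
  assumes "dual_pair V V' n e e'"
  shows "i < n \<Longrightarrow> e i \<in> V" "i < n \<Longrightarrow> e' i \<in> V'"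
    "i < n \<Longrightarrow> e i \<in> hom_elems L S" "i < n \<Longrightarrow> e' i \<in> hom_elems L S"
    "i < n \<Longrightarrow> par L (e' i) = par L (e i)"
    "x \<in> V \<Longrightarrow> x = (\<Sum>i<n. lscale L (B (e' i) x) (e i))"
    "x \<in> V' \<Longrightarrow> x = (\<Sum>i<n. lscale L (B x (e i)) (e' i))"
  using assms unfolding dual_pair_def hom_elems_def by blast+

lemma hlin_dual_pair:
  assumes "dual_pair V V' n e e'" "hlin \<phi>" "x \<in> part L p"
  shows "x \<in> V \<Longrightarrow> \<phi> x = (\<Sum>i<n. scal (B (e' i) x) (\<phi> (e i)))"
    "x \<in> V' \<Longrightarrow> \<phi> x = (\<Sum>i<n. scal (B x (e i)) (\<phi> (e' i)))"
proof -
  note e = dual_pairD[OF assms(1)]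
  have part: "e i \<in> part L (par L (e i))" "e' i \<in> part L (par L (e i))" if "i < n" for i
    using e(3-5)[OF that] hom_part by metis+
  have "B (e' i) x \<noteq> 0 \<Longrightarrow> even (par L (e i) + p)" "B x (e i) \<noteq> 0 \<Longrightarrow> even (par L (e' i) + p)"
    if "i < n" for i
    using form_part[OF part(2)[OF that] assms(3)] form_part[OF assms(3) part(1)[OF that]] e(5)[OF that]
    by (auto simp: add.commute)
  then have "\<phi> (\<Sum>i<n. lscale L (B (e' i) x) (e i)) = (\<Sum>i<n. scal (B (e' i) x) (\<phi> (e i)))"
    "\<phi> (\<Sum>i<n. lscale L (B x (e i)) (e' i)) = (\<Sum>i<n. scal (B x (e i)) (\<phi> (e' i)))"
    using e(3,4) by (auto intro!: hlin_lincomb[OF assms(2), where p = p])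
  then show "x \<in> V \<Longrightarrow> \<phi> x = (\<Sum>i<n. scal (B (e' i) x) (\<phi> (e i)))"
    "x \<in> V' \<Longrightarrow> \<phi> x = (\<Sum>i<n. scal (B x (e i)) (\<phi> (e' i)))"
    using e(6)[of x] e(7)[of x] by simp_all
qed

definition cubic_coeff :: "'g \<Rightarrow> 'g \<Rightarrow> 'g \<Rightarrow> complex" where
  "cubic_coeff x y z = (-1) ^ (par L x * par L y + par L z) * B (bracket L x y) z"

lemma hlin_cubic_coeff:
  "hlin (\<lambda>x. scal (cubic_coeff x y z) v)" "hlin (\<lambda>x. scal (cubic_coeff y x z) v)"
  "hlin (\<lambda>x. scal (cubic_coeff y z x) v)"
  using hlin_par[OF hlin_form(1), of "\<lambda>p. (-1) ^ (p * par L y + par L z)" y z v]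
    hlin_par[OF hlin_form(2), of "\<lambda>p. (-1) ^ (par L y * p + par L z)" y z v]
    hlin_par[OF hlin_form(3), of "\<lambda>p. (-1) ^ (par L y * par L z + p)" "bracket L y z" v]
  by (simp_all add: cubic_coeff_def)

end

context levi_action
begin

text \<open>Expand [X, e_i] in \<open>e\<close> and [X, e'_j] in \<open>e'\<close>. By invariance
  and skew-symmetry the two coefficient matrices are negative transposes of each other, up to the
  stated sign.\<close>

lemma casimir:
  assumes e: "dual_pair V V' N e e'" and stable: "\<And>x. x \<in> V \<Longrightarrow> bracket L X x \<in> V" "\<And>x. x \<in> V' \<Longrightarrow> bracket L X x \<in> V'"
    and \<psi>: "hbilin \<psi>"
  shows "(\<Sum>i<N. \<psi> (bracket L X (e i)) (e' i)) =
    - (\<Sum>i<N. scal ((-1) ^ (par L X * par L (e i))) (\<psi> (e i) (bracket L X (e' i))))"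
proof -
  note eD = dual_pairD[OF e]
  have part: "e i \<in> part L (par L (e i))" "e' i \<in> part L (par L (e i))" if "i < N" for i
    using eD(3-5)[OF that] hom_part by metis+
  have 1: "\<psi> (bracket L X (e i)) (e' i) = (\<Sum>j<N. scal (B (e' j) (bracket L X (e i))) (\<psi> (e j) (e' i)))"
    if i: "i < N" for i
    by (rule hlin_dual_pair(1)[OF e hbilinD(1)[OF \<psi> eD(4)[OF i]] bracket_X_part[OF part(1)[OF i]] stable(1)[OF eD(1)[OF i]]])
  have 2: "\<psi> (e j) (bracket L X (e' j)) = (\<Sum>i<N. scal (B (bracket L X (e' j)) (e i)) (\<psi> (e j) (e' i)))"
    if j: "j < N" for j
    by (rule hlin_dual_pair(2)[OF e hbilinD(2)[OF \<psi> eD(3)[OF j]] bracket_X_part[OF part(2)[OF j]] stable(2)[OF eD(2)[OF j]]])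
  have 3: "(-1) ^ (par L X * par L (e j)) * B (bracket L X (e' j)) (e i) = - B (e' j) (bracket L X (e i))"
    if "j < N" for i j
    using bracket_skew[OF hom_part[OF X_hom] part(2)[OF that]]
    by (simp add: form_minus form_scale_left form_invariant minus_one_power_mult_self flip: mult.assoc)
  have "(\<Sum>i<N. scal ((-1) ^ (par L X * par L (e i))) (\<psi> (e i) (bracket L X (e' i)))) =
      (\<Sum>j<N. \<Sum>i<N. scal (- B (e' j) (bracket L X (e i))) (\<psi> (e j) (e' i)))"
    by (intro sum.cong refl) (simp add: 2 3 scal.scale_sum_right flip: scal.scale_minus_left)
  also have "\<dots> = - (\<Sum>i<N. \<Sum>j<N. scal (B (e' j) (bracket L X (e i))) (\<psi> (e j) (e' i)))"
    by (subst sum.swap) (simp add: sum_negf)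
  also have "\<dots> = - (\<Sum>i<N. \<psi> (bracket L X (e i)) (e' i))"
    by (simp add: 1)
  finally show ?thesis by simp
qed

text \<open>Moves the action from \<open>e'\<close> to \<open>e\<close>, by applying
  \<open>casimir\<close> to \<open>\<psi>\<close> multiplied by the sign that this lemma puts on the
  other side.\<close>

lemma casimir_right:
  assumes e: "dual_pair V V' N e e'" and stable: "\<And>x. x \<in> V \<Longrightarrow> bracket L X x \<in> V" "\<And>x. x \<in> V' \<Longrightarrow> bracket L X x \<in> V'"
    and \<psi>: "hbilin \<psi>"
  shows "(\<Sum>i<N. \<psi> (e i) (bracket L X (e' i))) =
    (\<Sum>i<N. scal (- ((-1) ^ (par L X * (par L X + par L (e i))))) (\<psi> (bracket L X (e i)) (e' i)))"
proof -
  note eD = dual_pairD[OF e]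
  let ?\<psi> = "\<lambda>x y. scal ((-1) ^ (par L X * par L x)) (\<psi> x y)"
  have "hbilin ?\<psi>"
    using hbilinD[OF \<psi>] by (intro hbilinI hlin_par hlin_scal)
  from casimir[OF e stable this]
  have sum: "(\<Sum>i<N. ?\<psi> (bracket L X (e i)) (e' i)) = - (\<Sum>i<N. \<psi> (e i) (bracket L X (e' i)))"
    by (simp add: minus_one_power_mult_self)
  \<comment> \<open>The parity of [X, e_i] is the sum of the parities unless the bracket is zero,
    and then the term vanishes.\<close>
  have *: "?\<psi> (bracket L X (e i)) (e' i) =
      scal ((-1) ^ (par L X * (par L X + par L (e i)))) (\<psi> (bracket L X (e i)) (e' i))" if "i < N" for i
  proof (cases "bracket L X (e i) = 0")
    case True
    then show ?thesis using hlin_zero[OF hbilinD(1)[OF \<psi> eD(4)[OF that]]] by simp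
  next
    case False
    have "even (par L (bracket L X (e i)) + (par L X + par L (e i)))"
      using False eD(3)[OF that] bracket_X_part hom_part by (intro par_part) auto
    then show ?thesis by (auto simp: minus_one_power_iff)
  qed
  have "(\<Sum>i<N. ?\<psi> (bracket L X (e i)) (e' i)) = (\<Sum>i<N.
      scal ((-1) ^ (par L X * (par L X + par L (e i)))) (\<psi> (bracket L X (e i)) (e' i)))"
    by (intro sum.cong refl *) simp
  with sum show ?thesis by (simp add: sum_negf)
qed

text \<open>The outer signs are those produced by \<open>casimir_right\<close>, the inner ones those
  of the Leibniz rule in \<open>\<delta>_W\<close>. Invariance of \<open>B\<close> turns the third
  term into one with \<open>X\<close> acting on [x, y], and the Jacobi identity splits it into the
  other two.\<close>

lemma cubic_coeff_invariant:
  assumes "x \<in> hom_elems L S" "y \<in> hom_elems L S" "z \<in> hom_elems L S"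
  shows "(-1) ^ (par L X * (par L X + par L x)) * cubic_coeff (bracket L X x) y z
    + (-1) ^ (par L X * (par L X + par L y)) * ((-1) ^ (par L X * par L x) * cubic_coeff x (bracket L X y) z)
    + (-1) ^ (par L X * (par L X + par L z)) * ((-1) ^ (par L X * (par L x + par L y)) * cubic_coeff x y (bracket L X z)) = 0"
proof -
  let ?\<xi> = "par L X" and ?p = "par L x" and ?q = "par L y" and ?r = "par L z"
  let ?b1 = "B (bracket L (bracket L X x) y) z" and ?b2 = "B (bracket L x (bracket L X y)) z"
    and ?b3 = "B (bracket L x y) (bracket L X z)"
  have part: "X \<in> part L ?\<xi>" "x \<in> part L ?p" "y \<in> part L ?q" "z \<in> part L ?r"
    using assms X_hom hom_part by blast+
  have sign: "v = 0 \<or> even (par L v) = even q" if "v \<in> part L q" for v q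
    using par_part[OF that] by auto
  have c: "cubic_coeff (bracket L X x) y z = (-1) ^ ((?\<xi> + ?p) * ?q + ?r) * ?b1"
    "cubic_coeff x (bracket L X y) z = (-1) ^ (?p * (?\<xi> + ?q) + ?r) * ?b2"
    "cubic_coeff x y (bracket L X z) = (-1) ^ (?p * ?q + (?\<xi> + ?r)) * ?b3"
    using sign[OF bracket_part[OF part(1,2)]] sign[OF bracket_part[OF part(1,3)]]
      sign[OF bracket_part[OF part(1,4)]]
    by (auto simp: cubic_coeff_def minus_one_power_iff)
  have "?b3 = B (bracket L (bracket L x y) X) z" by (simp add: form_invariant)
  also have "\<dots> = - ((-1) ^ (?\<xi> * (?p + ?q)) * B (bracket L X (bracket L x y)) z)"
    using bracket_skew[OF bracket_part[OF part(2,3)] part(1)]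
    by (simp add: form_minus form_scale_left mult.commute)
  also have "B (bracket L X (bracket L x y)) z = ?b1 + (-1) ^ (?\<xi> * ?p) * ?b2"
    using bracket_jacobi[OF part(1,2)] by (simp add: form_add_left form_scale_left)
  finally have b3: "?b3 = - ((-1) ^ (?\<xi> * (?p + ?q)) * (?b1 + (-1) ^ (?\<xi> * ?p) * ?b2))" .
  show ?thesis
  \<comment> \<open>For even total parity the parity of \<open>z\<close> is determined by the
    others, leaving eight sign checks. For odd total parity all the forms vanish.\<close>
  proof (cases "even (?\<xi> + ?p + ?q + ?r)")
    case True
    then show ?thesis
      unfolding c b3
      by (cases "even ?\<xi>"; cases "even ?p"; cases "even ?q"; simp add: minus_one_power_iff)
  next
    case False
    then have "?b1 = 0" "?b2 = 0"
      using form_part[OF bracket_part[OF bracket_part[OF part(1,2)] part(3)] part(4)]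
        form_part[OF bracket_part[OF part(2) bracket_part[OF part(1,3)]] part(4)]
      by (simp_all add: ac_simps)
    then show ?thesis unfolding c b3 by simp
  qed
qed

text \<open>The Leibniz rule gives one sum for each wedge factor. \<open>casimir_right\<close> moves
  the action from that factor into the coefficient, and the three coefficients cancel. Three
  different pairs are allowed because \<open>a\<close> and its conjugate mix the two
  tensors.\<close>

lemma cubic_invariant:
  assumes e: "dual_pair V1 V1' l e e'" and f: "dual_pair V2 V2' m f f'" and g: "dual_pair V3 V3' N g g'"
    and stable: "\<And>x V. V \<in> {V1, V1', V2, V2', V3, V3'} \<Longrightarrow> x \<in> V \<Longrightarrow> bracket L X x \<in> V"
  shows "\<delta> (tensor 1 (\<Sum>i<l. \<Sum>j<m. \<Sum>k<N.
    scal (cubic_coeff (e i) (f j) (g k)) (quant_wedge L [e' i, f' j, g' k]))) = 0"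
proof -
  let ?\<xi> = "par L X" and ?c = cubic_coeff and ?X = "bracket L X"
  note eD = dual_pairD[OF e] and fD = dual_pairD[OF f] and gD = dual_pairD[OF g]
  interpret t: Vector_Spaces.linear scal scal "tensor (1 :: 'g free)" by (rule linear_tensor_right)
  have "\<delta> (tensor 1 (\<Sum>i<l. \<Sum>j<m. \<Sum>k<N.
      scal (?c (e i) (f j) (g k)) (quant_wedge L [e' i, f' j, g' k]))) =
    (\<Sum>i<l. \<Sum>j<m. \<Sum>k<N. scal (?c (e i) (f j) (g k)) (W (?X (e' i)) (f' j) (g' k)))
    + (\<Sum>i<l. \<Sum>j<m. \<Sum>k<N. scal ((-1) ^ (?\<xi> * par L (e i)) * ?c (e i) (f j) (g k)) (W (e' i) (?X (f' j)) (g' k)))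
    + (\<Sum>i<l. \<Sum>j<m. \<Sum>k<N. scal ((-1) ^ (?\<xi> * (par L (e i) + par L (f j))) * ?c (e i) (f j) (g k)) (W (e' i) (f' j) (?X (g' k))))"
    using eD(4,5) fD(4,5) gD(4)
    by (simp add: t.sum t.scale \<delta>.sum \<delta>.scale \<delta>_W scal.scale_right_distrib sum.distrib mult.commute)
  also have "(\<Sum>i<l. \<Sum>j<m. \<Sum>k<N. scal (?c (e i) (f j) (g k)) (W (?X (e' i)) (f' j) (g' k))) =
    (\<Sum>i<l. \<Sum>j<m. \<Sum>k<N. scal (- ((-1) ^ (?\<xi> * (?\<xi> + par L (e i))) * ?c (?X (e i)) (f j) (g k))) (W (e' i) (f' j) (g' k)))"
  proof -
    have "(\<Sum>i<l. scal (?c (e i) (f j) (g k)) (W (?X (e' i)) (f' j) (g' k))) =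
      (\<Sum>i<l. scal (- ((-1) ^ (?\<xi> * (?\<xi> + par L (e i))) * ?c (?X (e i)) (f j) (g k))) (W (e' i) (f' j) (g' k)))"
      if "j < m" "k < N" for j k
    proof -
      have "hbilin (\<lambda>x y. scal (?c x (f j) (g k)) (W y (f' j) (g' k)))"
        using that fD(4) gD(4) by (intro hbilinI hlin_scal hlin_cubic_coeff hlin_W) auto
      from casimir_right[OF e stable stable this] show ?thesis by (simp add: mult_ac)
    qed
    then show ?thesis
      by (subst (1 2) sum.swap, subst (2 4) sum.swap)  simp
  qed
  also have "(\<Sum>i<l. \<Sum>j<m. \<Sum>k<N. scal ((-1) ^ (?\<xi> * par L (e i)) * ?c (e i) (f j) (g k)) (W (e' i) (?X (f' j)) (g' k))) =
    (\<Sum>i<l. \<Sum>j<m. \<Sum>k<N. scal (- ((-1) ^ (?\<xi> * (?\<xi> + par L (f j))) * ((-1) ^ (?\<xi> * par L (e i)) * ?c (e i) (?X (f j)) (g k)))) (W (e' i) (f' j) (g' k)))"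
  proof -
    have "(\<Sum>j<m. scal ((-1) ^ (?\<xi> * par L (e i)) * ?c (e i) (f j) (g k)) (W (e' i) (?X (f' j)) (g' k))) =
      (\<Sum>j<m. scal (- ((-1) ^ (?\<xi> * (?\<xi> + par L (f j))) * ((-1) ^ (?\<xi> * par L (e i)) * ?c (e i) (?X (f j)) (g k)))) (W (e' i) (f' j) (g' k)))"
      if "i < l" "k < N" for i k
    proof -
      have "hbilin (\<lambda>x y. scal ((-1) ^ (?\<xi> * par L (e i))) (scal (?c (e i) x (g k)) (W (e' i) y (g' k))))"
        using that eD(4) gD(4) by (intro hbilinI hlin_scal hlin_cubic_coeff hlin_W) auto
      from casimir_right[OF f stable stable this] show ?thesis by (simp add: mult_ac)
    qed
    then show ?thesis
      by - (rule sum.cong[OF refl], subst (1 2) sum.swap, simp)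
  qed
  also have "(\<Sum>i<l. \<Sum>j<m. \<Sum>k<N. scal ((-1) ^ (?\<xi> * (par L (e i) + par L (f j))) * ?c (e i) (f j) (g k)) (W (e' i) (f' j) (?X (g' k)))) =
    (\<Sum>i<l. \<Sum>j<m. \<Sum>k<N. scal (- ((-1) ^ (?\<xi> * (?\<xi> + par L (g k))) * ((-1) ^ (?\<xi> * (par L (e i) + par L (f j))) * ?c (e i) (f j) (?X (g k))))) (W (e' i) (f' j) (g' k)))"
  proof -
    have "(\<Sum>k<N. scal ((-1) ^ (?\<xi> * (par L (e i) + par L (f j))) * ?c (e i) (f j) (g k)) (W (e' i) (f' j) (?X (g' k)))) =
      (\<Sum>k<N. scal (- ((-1) ^ (?\<xi> * (?\<xi> + par L (g k))) * ((-1) ^ (?\<xi> * (par L (e i) + par L (f j))) * ?c (e i) (f j) (?X (g k))))) (W (e' i) (f' j) (g' k)))"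
      if "i < l" "j < m" for i j
    proof -
      have "hbilin (\<lambda>x y. scal ((-1) ^ (?\<xi> * (par L (e i) + par L (f j)))) (scal (?c (e i) (f j) x) (W (e' i) (f' j) y)))"
        using that eD(4) fD(4) by (intro hbilinI hlin_scal hlin_cubic_coeff hlin_W) auto
      from casimir_right[OF g stable stable this] show ?thesis by (simp add: mult_ac)
    qed
    then show ?thesis by simp
  qed
  also have "(\<Sum>i<l. \<Sum>j<m. \<Sum>k<N. scal (- ((-1) ^ (?\<xi> * (?\<xi> + par L (e i))) * ?c (?X (e i)) (f j) (g k))) (W (e' i) (f' j) (g' k)))
    + (\<Sum>i<l. \<Sum>j<m. \<Sum>k<N. scal (- ((-1) ^ (?\<xi> * (?\<xi> + par L (f j))) * ((-1) ^ (?\<xi> * par L (e i)) * ?c (e i) (?X (f j)) (g k)))) (W (e' i) (f' j) (g' k)))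
    + (\<Sum>i<l. \<Sum>j<m. \<Sum>k<N. scal (- ((-1) ^ (?\<xi> * (?\<xi> + par L (g k))) * ((-1) ^ (?\<xi> * (par L (e i) + par L (f j))) * ?c (e i) (f j) (?X (g k))))) (W (e' i) (f' j) (g' k)))
    = (\<Sum>i<l. \<Sum>j<m. \<Sum>k<N. scal (- ((-1) ^ (?\<xi> * (?\<xi> + par L (e i))) * ?c (?X (e i)) (f j) (g k)
        + (-1) ^ (?\<xi> * (?\<xi> + par L (f j))) * ((-1) ^ (?\<xi> * par L (e i)) * ?c (e i) (?X (f j)) (g k))
        + (-1) ^ (?\<xi> * (?\<xi> + par L (g k))) * ((-1) ^ (?\<xi> * (par L (e i) + par L (f j))) * ?c (e i) (f j) (?X (g k)))))
        (W (e' i) (f' j) (g' k)))"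
    by (simp only: sum.distrib[symmetric] scal.scale_left_distrib[symmetric] minus_add_distrib)
  also have "\<dots> = 0"
    using eD(3) fD(3) gD(3) by (intro sum.neutral ballI, subst cubic_coeff_invariant) auto
  finally show ?thesis .
qed

end

section \<open>Decomposition along dual pairs\<close>

context clifford_setting
begin

lemma par_scale: "c \<noteq> 0 \<Longrightarrow> par L (lscale L c x) = par L x"
  using subspace_scale[OF subspace_odd, of x c] subspace_scale[OF subspace_odd, of "lscale L c x" "inverse c"]
  by (auto simp: par_def)

lemma hom_elems_scale: "x \<in> hom_elems L S \<Longrightarrow> lscale L c x \<in> hom_elems L S"
  using part_hom part_scale subspace_scale[OF subspace_S] by (metis hom_elems_iff)

text \<open>One homogeneous argument suffices: only the component of \<open>x\<close> of the same
  parity contributes, and p * p has the parity of p.\<close>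

lemma form_sym_homogeneous:
  assumes "e \<in> part L p"
  shows "B e x = (-1) ^ p * B x e"
proof -
  obtain a b where a: "a \<in> part L 0" and b: "b \<in> part L 1" and x: "x = a + b"
    using even_plus_odd[of x] by auto
  show ?thesis
  proof (cases "even p")
    case True
    then show ?thesis
      using form_sym[OF assms a] form_part[OF assms b] form_part[OF b assms]
      by (simp add: x form_add_left form_add_right)
  next
    case False
    then show ?thesis
      using form_sym[OF assms b] form_part[OF assms a] form_part[OF a assms]
      by (simp add: x form_add_left form_add_right)
  qed
qed

lemma dual_basis_dual_pair:
  assumes X: "homogeneous_basis L V m X" and Y: "dual_basis L B V' m X Y" and V': "graded V'"
    and S: "V \<subseteq> S" "V' \<subseteq> S"
  shows "dual_pair V V' m X Y"
  unfolding dual_pair_def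
proof (intro conjI allI impI ballI S)
  fix i assume i: "i < m"
  show "X i \<in> hom_elems L V" using X i by (simp add: homogeneous_basis_def)
  have Yi: "Y i \<in> part L (par L (X i))" using dual_basis_part[OF X Y V' i] .
  moreover have "Y i \<in> V'"
    using Y i by (auto simp: dual_basis_def indexed_basis_def intro: span_base)
  ultimately show "Y i \<in> hom_elems L V'" by (intro part_hom)
  have "B (Y i) (X i) = 1" using Y i by (simp add: dual_basis_def)
  then have "Y i \<noteq> 0" by auto
  with Yi have "even (par L (Y i) + par L (X i))" by (rule par_part)
  moreover have "par L (Y i) < 2" "par L (X i) < 2" by (simp_all add: par_def)
  ultimately show "par L (Y i) = par L (X i)" by presburger
qed (use dual_basis_expand_left[OF X Y] dual_basis_expand_right[OF Y] in blast)+

text \<open>Exchanging the members of a dual pair reverses the arguments of the form, and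
  supersymmetry then costs this sign. Putting it into the vector makes the reversed family a dual
  pair again.\<close>

definition twist :: "(nat \<Rightarrow> 'g) \<Rightarrow> nat \<Rightarrow> 'g" where
  "twist e i = lscale L ((-1) ^ par L (e i)) (e i)"

lemma dual_pair_twist:
  assumes "dual_pair V V' m e e'" "subspace V"
  shows "dual_pair V' V m e' (twist e)"
  unfolding dual_pair_def
proof (intro conjI allI impI ballI)
  note e = dual_pairD[OF assms(1)]
  show "V' \<subseteq> S" "V \<subseteq> S" using assms(1) by (simp_all add: dual_pair_def)
  show "e' i \<in> hom_elems L V'" if "i < m" for i
    using assms(1) that by (simp add: dual_pair_def)
  show "par L (twist e i) = par L (e' i)" if "i < m" for i
    using e(5)[OF that] by (simp add: twist_def par_scale)
  show "twist e i \<in> hom_elems L V" if "i < m" for i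
    using e(1,3)[OF that] assms(2)
    by (auto simp: twist_def hom_elems_iff par_scale intro: subspace_scale part_scale)
  have part: "e i \<in> part L (par L (e i))" "e' i \<in> part L (par L (e i))" if "i < m" for i
    using e(3-5)[OF that] hom_part by metis+
  show "x = (\<Sum>i<m. lscale L (B (twist e i) x) (e' i))" if "x \<in> V'" for x
  proof -
    have "B (twist e i) x = B x (e i)" if "i < m" for i
      using form_sym_homogeneous[OF part(1)[OF that], of x]
      by (simp add: twist_def form_scale_left minus_one_power_mult_self flip: mult.assoc)
    then show ?thesis using e(7)[OF that] by simp
  qed
  show "x = (\<Sum>i<m. lscale L (B x (e' i)) (twist e i))" if "x \<in> V" for x
  proof -
    have "lscale L (B x (e' i)) (twist e i) = lscale L (B (e' i) x) (e i)" if "i < m" for i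
      using form_sym_homogeneous[OF part(2)[OF that], of x] by (simp add: twist_def mult.commute)
    then show ?thesis using e(6)[OF that] by simp
  qed
qed

text \<open>Basis independence of the canonical tensor of S: expand each first factor along the two
  isotropic halves, exchange the sums, and reassemble the second factors from
  \<open>X'\<close>.\<close>

lemma sum_dual_pair_split:
  assumes X: "dual_pair S S m X X'" and u: "dual_pair U U' s u u'" "subspace U"
    and S: "S = {x + y | x y. x \<in> U \<and> y \<in> U'}"
    and isotropic: "\<And>x y. x \<in> U \<Longrightarrow> y \<in> U \<Longrightarrow> B x y = 0" "\<And>x y. x \<in> U' \<Longrightarrow> y \<in> U' \<Longrightarrow> B x y = 0"
    and \<psi>: "hbilin \<psi>"
  shows "(\<Sum>i<m. \<psi> (X i) (X' i)) = (\<Sum>a<s. \<psi> (u a) (u' a)) + (\<Sum>a<s. \<psi> (u' a) (twist u a))"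
proof -
  note v = dual_pair_twist[OF u]
  note XD = dual_pairD[OF X] and uD = dual_pairD[OF u(1)] and vD = dual_pairD[OF v]
  have expand: "\<phi> x = (\<Sum>a<s. scal (B (u' a) x) (\<phi> (u a))) + (\<Sum>a<s. scal (B (twist u a) x) (\<phi> (u' a)))"
    if \<phi>: "hlin \<phi>" and x_hom: "x \<in> hom_elems L S" for \<phi> :: "'g \<Rightarrow> ('b \<Rightarrow>\<^sub>0 complex)" and x
  proof -
    obtain y z where x: "x = y + z" and y: "y \<in> U" and z: "z \<in> U'"
      using x_hom S by (auto simp: hom_elems_def)
    \<comment> \<open>Isotropy makes the coefficients of the two components depend on
      \<open>x\<close> itself, without choosing a splitting.\<close>
    have "B (u' a) x = B (u' a) y" "B (twist u a) x = B (twist u a) z" if "a < s" for a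
      using isotropic(2)[OF uD(2)[OF that] z] isotropic(1)[OF vD(2)[OF that] y] by (simp_all add: x form_add_right)
    then have x': "x = (\<Sum>a<s. lscale L (B (u' a) x) (u a)) + (\<Sum>a<s. lscale L (B (twist u a) x) (u' a))"
      using x uD(6)[OF y] vD(6)[OF z] by simp
    have xp: "x \<in> part L (par L x)" using x_hom hom_part by blast
    have c: "even (par L (u a) + par L x)" if "a < s" "B (u' a) x \<noteq> 0" for a
      using form_part[OF hom_part[OF uD(4)[OF that(1)]] xp] that uD(5) by auto
    have d: "even (par L (u' a) + par L x)" if "a < s" "B (twist u a) x \<noteq> 0" for a
      using form_part[OF hom_part[OF vD(4)[OF that(1)]] xp] that vD(5) by auto
    have "(\<Sum>a<s. lscale L (B (u' a) x) (u a)) \<in> S \<inter> part L (par L x)"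
      "(\<Sum>a<s. lscale L (B (twist u a) x) (u' a)) \<in> S \<inter> part L (par L x)"
      using c d uD(3,4) by (auto intro!: subspace_sum subspace_inter subspace_S subspace_part lincomb_part
        simp del: Int_iff)
    then have "\<phi> x = \<phi> (\<Sum>a<s. lscale L (B (u' a) x) (u a)) + \<phi> (\<Sum>a<s. lscale L (B (twist u a) x) (u' a))"
      using hlin_add[OF \<phi>] by (subst x') blast
    also have "\<phi> (\<Sum>a<s. lscale L (B (u' a) x) (u a)) = (\<Sum>a<s. scal (B (u' a) x) (\<phi> (u a)))"
      using c uD(3) by (auto intro!: hlin_lincomb[OF \<phi>, where p = "par L x"])
    also have "\<phi> (\<Sum>a<s. lscale L (B (twist u a) x) (u' a)) = (\<Sum>a<s. scal (B (twist u a) x) (\<phi> (u' a)))"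
      using d uD(4) by (auto intro!: hlin_lincomb[OF \<phi>, where p = "par L x"])
    finally show ?thesis .
  qed
  have 1: "\<psi> (u a) (u' a) = (\<Sum>i<m. scal (B (u' a) (X i)) (\<psi> (u a) (X' i)))" if "a < s" for a
    using hlin_dual_pair(2)[OF X hbilinD(2)[OF \<psi> uD(3)[OF that]] hom_part[OF uD(4)[OF that]]] uD(4)[OF that]
    by (simp add: hom_elems_iff)
  have 2: "\<psi> (u' a) (twist u a) = (\<Sum>i<m. scal (B (twist u a) (X i)) (\<psi> (u' a) (X' i)))" if "a < s" for a
    using hlin_dual_pair(2)[OF X hbilinD(2)[OF \<psi> vD(3)[OF that]] hom_part[OF vD(4)[OF that]]] vD(4)[OF that]
    by (simp add: hom_elems_iff)
  have "(\<Sum>i<m. \<psi> (X i) (X' i)) = (\<Sum>i<m. (\<Sum>a<s. scal (B (u' a) (X i)) (\<psi> (u a) (X' i)))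
      + (\<Sum>a<s. scal (B (twist u a) (X i)) (\<psi> (u' a) (X' i))))"
    using XD(3,4) by (intro sum.cong refl expand hbilinD(1)[OF \<psi>]) auto
  \<comment> \<open>The inner sums over \<open>i\<close> are the expansions of \<open>u' a\<close>
    and \<open>twist u a\<close> in the family \<open>X'\<close>.\<close>
  also have "\<dots> = (\<Sum>a<s. \<psi> (u a) (u' a)) + (\<Sum>a<s. \<psi> (u' a) (twist u a))"
    unfolding sum.distrib by (subst (1 2) sum.swap) (simp add: 1 2)
  finally show ?thesis .
qed

text \<open>A family with its partner is one argument, so this behaves like a symmetric trilinear
  form in canonical tensors.\<close>

fun cubic :: "nat \<times> (nat \<Rightarrow> 'g) \<times> (nat \<Rightarrow> 'g) \<Rightarrow> nat \<times> (nat \<Rightarrow> 'g) \<times> (nat \<Rightarrow> 'g) \<Rightarrow>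
    nat \<times> (nat \<Rightarrow> 'g) \<times> (nat \<Rightarrow> 'g) \<Rightarrow> 'g free2" where
  "cubic (l, e, e') (m, f, f') (n, g, g') = (\<Sum>i<l. \<Sum>j<m. \<Sum>k<n.
     scal (cubic_coeff (e i) (f j) (g k)) (W (e' i) (f' j) (g' k)))"

definition hom_family :: "nat \<times> (nat \<Rightarrow> 'g) \<times> (nat \<Rightarrow> 'g) \<Rightarrow> bool" where
  "hom_family = (\<lambda>(n, e, e'). \<forall>i<n. e i \<in> hom_elems L S \<and> e' i \<in> hom_elems L S \<and> par L (e' i) = par L (e i))"

lemma dual_pair_hom_family: "dual_pair V V' m e e' \<Longrightarrow> hom_family (m, e, e')"
  using dual_pairD by (auto simp: hom_family_def)

text \<open>Bracket and wedge both change by minus the Koszul sign of the first two parities, so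
  their product is unchanged.\<close>

lemma cubic_swap_12:
  assumes "hom_family E" "hom_family F"
  shows "cubic E F G = cubic F E G"
proof (cases E; cases F; cases G)
  fix l e e' m f f' n g g'
  assume EFG: "E = (l, e, e')" "F = (m, f, f')" "G = (n, g, g')"
  have "scal (cubic_coeff (e i) (f j) (g k)) (W (e' i) (f' j) (g' k)) =
      scal (cubic_coeff (f j) (e i) (g k)) (W (f' j) (e' i) (g' k))" if "i < l" "j < m" for i j k
  proof -
    have ef: "e i \<in> part L (par L (e i))" "f j \<in> part L (par L (f j))"
      and par: "par L (e' i) = par L (e i)" "par L (f' j) = par L (f j)"
      using assms that hom_part by (auto simp: EFG hom_family_def)
    have "B (bracket L (f j) (e i)) (g k) = - ((-1) ^ (par L (f j) * par L (e i)) * B (bracket L (e i) (f j)) (g k))"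
      using bracket_skew[OF ef(2,1)] by (simp add: form_minus form_scale_left)
    then show ?thesis
      by (simp add: cubic_coeff_def W_swap(1)[of "f' j" "e' i"] par)
        (simp add: minus_one_power_iff)
  qed
  then show ?thesis unfolding EFG cubic.simps by (subst (2) sum.swap) simp
qed

text \<open>Invariance of \<open>B\<close> moves the exchange inside a bracket. The remaining signs
  of the coefficients differ by (-1)^((p+1)(q+r)), for parities p, q, r. This is 1 when p+q+r is
  even, and otherwise the form vanishes.\<close>

lemma cubic_swap_23:
  assumes "hom_family E" "hom_family F" "hom_family G"
  shows "cubic E F G = cubic E G F"
proof (cases E; cases F; cases G)
  fix l e e' m f f' n g g'
  assume EFG: "E = (l, e, e')" "F = (m, f, f')" "G = (n, g, g')"
  have "scal (cubic_coeff (e i) (f j) (g k)) (W (e' i) (f' j) (g' k)) =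
      scal (cubic_coeff (e i) (g k) (f j)) (W (e' i) (g' k) (f' j))" if "i < l" "j < m" "k < n" for i j k
  proof -
    have ef: "e i \<in> part L (par L (e i))" "f j \<in> part L (par L (f j))" "g k \<in> part L (par L (g k))"
      and par: "par L (f' j) = par L (f j)" "par L (g' k) = par L (g k)"
      using assms that hom_part by (auto simp: EFG hom_family_def)
    have *: "B (bracket L (e i) (g k)) (f j) = - ((-1) ^ (par L (g k) * par L (f j)) * B (bracket L (e i) (f j)) (g k))"
      using bracket_skew[OF ef(3,2)] by (simp add: form_minus form_scale_right form_invariant)
    have "B (bracket L (e i) (f j)) (g k) = 0" if "odd (par L (e i) + par L (f j) + par L (g k))"
      using form_part[OF bracket_part[OF ef(1,2)] ef(3)] that by simp
    then show ?thesis
      by (cases "even (par L (e i) + par L (f j) + par L (g k))";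
          simp add: cubic_coeff_def * W_swap(2)[of "e' i" "g' k" "f' j"] par;
          auto simp: minus_one_power_iff)
  qed
  then show ?thesis unfolding EFG cubic.simps by - (rule sum.cong[OF refl], subst (2) sum.swap, simp)
qed

lemma cubic_split:
  assumes X: "dual_pair S S m X X'" and u: "dual_pair U U' s u u'" "subspace U"
    and S: "S = {x + y | x y. x \<in> U \<and> y \<in> U'}"
    and isotropic: "\<And>x y. x \<in> U \<Longrightarrow> y \<in> U \<Longrightarrow> B x y = 0" "\<And>x y. x \<in> U' \<Longrightarrow> y \<in> U' \<Longrightarrow> B x y = 0"
    and FG: "hom_family F" "hom_family G"
  shows "cubic (m, X, X') F G = cubic (s, u, u') F G + cubic (s, u', twist u) F G"
proof (cases F; cases G)
  fix m' f f' n g g'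
  assume [simp]: "F = (m', f, f')" "G = (n, g, g')"
  let ?T = "\<lambda>x x' j k. scal (cubic_coeff x (f j) (g k)) (W x' (f' j) (g' k))"
  have "(\<Sum>i<m. ?T (X i) (X' i) j k) = (\<Sum>i<s. ?T (u i) (u' i) j k) + (\<Sum>i<s. ?T (u' i) (twist u i) j k)"
    if "j < m'" "k < n" for j k
  proof (rule sum_dual_pair_split[OF X u S isotropic])
    show "hbilin (\<lambda>x x'. ?T x x' j k)"
      using FG that by (intro hbilinI hlin_scal hlin_cubic_coeff hlin_W) (auto simp: hom_family_def)
  qed
  then have "(\<Sum>j<m'. \<Sum>k<n. \<Sum>i<m. ?T (X i) (X' i) j k) =
      (\<Sum>j<m'. \<Sum>k<n. \<Sum>i<s. ?T (u i) (u' i) j k) + (\<Sum>j<m'. \<Sum>k<n. \<Sum>i<s. ?T (u' i) (twist u i) j k)"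
    by (simp add: sum.distrib)
  moreover have "(\<Sum>i<a. \<Sum>j<m'. \<Sum>k<n. H i j k) = (\<Sum>j<m'. \<Sum>k<n. \<Sum>i<a. H i j k)" for H :: "nat \<Rightarrow> nat \<Rightarrow> nat \<Rightarrow> 'g free2" and a
    by (subst sum.swap) (intro sum.cong refl sum.swap)
  ultimately show ?thesis by simp
qed

text \<open>The binomial cube for a symmetric trilinear form: the pure cubes vanish by
  \<open>triple\<close>, and the 3 counts the positions of the odd factor out.\<close>

lemma cubic_decompose:
  assumes X: "dual_pair S S m X X'" and u: "dual_pair U U' s u u'" "subspace U"
    and S: "S = {x + y | x y. x \<in> U \<and> y \<in> U'}"
    and isotropic: "\<And>x y. x \<in> U \<Longrightarrow> y \<in> U \<Longrightarrow> B x y = 0" "\<And>x y. x \<in> U' \<Longrightarrow> y \<in> U' \<Longrightarrow> B x y = 0"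
    and triple: "\<And>x y z. x \<in> U \<Longrightarrow> y \<in> U \<Longrightarrow> z \<in> U \<Longrightarrow> B (bracket L x y) z = 0"
      "\<And>x y z. x \<in> U' \<Longrightarrow> y \<in> U' \<Longrightarrow> z \<in> U' \<Longrightarrow> B (bracket L x y) z = 0"
  defines "E \<equiv> (m, X, X')" and "E1 \<equiv> (s, u, u')" and "E2 \<equiv> (s, u', twist u)"
  shows "cubic E E E = scal 3 (cubic E1 E1 E2 + cubic E2 E2 E1)"
proof -
  note uD = dual_pairD[OF u(1)]
  have fam: "hom_family E" "hom_family E1" "hom_family E2"
    unfolding E_def E1_def E2_def
    using dual_pair_hom_family X u dual_pair_twist by blast+
  have split: "cubic E F G = cubic E1 F G + cubic E2 F G" if "hom_family F" "hom_family G" for F G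
    unfolding E_def E1_def E2_def by (rule cubic_split[OF X u S isotropic that])
  have "cubic E1 E1 E1 = 0" "cubic E2 E2 E2 = 0"
    using uD(1,2) triple by (auto simp: E1_def E2_def cubic_coeff_def intro!: sum.neutral)
  \<comment> \<open>Additivity is known in the first slot only, and symmetry carries it to the other
    two.\<close>
  moreover have split2: "cubic F E G = cubic F E1 G + cubic F E2 G" if "hom_family F" "hom_family G" for F G
    using split[OF that] by (simp only: cubic_swap_12[OF fam(1) that(1)] cubic_swap_12[OF fam(2) that(1)]
      cubic_swap_12[OF fam(3) that(1)])
  have split3: "cubic F G E = cubic F G E1 + cubic F G E2" if "hom_family F" "hom_family G" for F G
    using split2[OF that] by (simp only: cubic_swap_23[OF that(1) fam(1) that(2)]
      cubic_swap_23[OF that(1) fam(2) that(2)] cubic_swap_23[OF that(1) fam(3) that(2)])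
  have "cubic E E E = cubic E1 E1 E1 + cubic E1 E1 E2 + cubic E1 E2 E1 + cubic E1 E2 E2
      + (cubic E2 E1 E1 + cubic E2 E1 E2 + cubic E2 E2 E1 + cubic E2 E2 E2)"
    by (simp only: split[OF fam(1,1)] split2[OF fam(2,1)] split2[OF fam(3,1)] split3[OF fam(2,2)]
        split3[OF fam(2,3)] split3[OF fam(3,2)] split3[OF fam(3,3)] ac_simps)
  moreover have "cubic E2 E1 E1 = cubic E1 E2 E1" "cubic E1 E2 E2 = cubic E2 E1 E2"
    by (rule cubic_swap_12[OF fam(3,2)] cubic_swap_12[OF fam(2,3)])+
  moreover have "cubic E1 E2 E1 = cubic E1 E1 E2" "cubic E2 E1 E2 = cubic E2 E2 E1"
    by (rule cubic_swap_23[OF fam(2,3,2)] cubic_swap_23[OF fam(3,2,3)])+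
  moreover have "scal 3 a = a + a + a" for a :: "'g free2"
    using scal.scale_left_distrib[of 1 2 a] scal.scale_left_distrib[of 1 1 a] by simp
  ultimately show ?thesis by simp
qed

end

section \<open>The summands of the cubic Dirac operator\<close>

context clifford_setting
begin

text \<open>The common property of projecting and of applying \<open>\<delta>\<close>, so that the
  twisted form of \<open>a\<close> is derived once for both. Scaling must be demanded separately,
  since a scaled vector is a different free generator. The scalar is nonzero so that
  \<open>par\<close> does not change.\<close>

definition wedge_linear :: "('g free \<Rightarrow> 'g free2) \<Rightarrow> bool" where
  "wedge_linear \<Lambda> \<longleftrightarrow> Vector_Spaces.linear scal scal \<Lambda> \<and>
    (\<forall>c x y z. c \<noteq> 0 \<longrightarrow> x \<in> hom_elems L S \<longrightarrow> y \<in> hom_elems L S \<longrightarrow> z \<in> hom_elems L S \<longrightarrow>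
      \<Lambda> (quant_wedge L [lscale L c x, y, z]) = scal c (\<Lambda> (quant_wedge L [x, y, z])) \<and>
      \<Lambda> (quant_wedge L [x, lscale L c y, z]) = scal c (\<Lambda> (quant_wedge L [x, y, z])) \<and>
      \<Lambda> (quant_wedge L [x, y, lscale L c z]) = scal c (\<Lambda> (quant_wedge L [x, y, z])))"

lemma wedge_linear_twist:
  assumes "wedge_linear \<Lambda>" "u i \<in> hom_elems L S" "x \<in> hom_elems L S"
  shows "y \<in> hom_elems L S \<Longrightarrow>
      \<Lambda> (quant_wedge L [x, y, twist u i]) = scal ((-1) ^ par L (u i)) (\<Lambda> (quant_wedge L [x, y, u i]))"
    "u j \<in> hom_elems L S \<Longrightarrow> \<Lambda> (quant_wedge L [twist u i, twist u j, x]) =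
      scal ((-1) ^ par L (u i) * (-1) ^ par L (u j)) (\<Lambda> (quant_wedge L [u i, u j, x]))"
  using assms by (simp_all add: wedge_linear_def twist_def hom_elems_scale)

text \<open>In \<open>a\<close> the extra signs of \<open>u i\<close> and \<open>u j\<close> are
  those of two twisted wedge factors. This exhibits both cubic terms as contractions of canonical
  tensors.\<close>

lemma wedge_linear_op_a:
  assumes \<Lambda>: "wedge_linear \<Lambda>" and u: "hom_family (s, u, u')"
  shows "\<Lambda> (op_a L B s u u') = scal (- 1 / 4) (\<Lambda> (\<Sum>i<s. \<Sum>j<s. \<Sum>k<s.
      scal (cubic_coeff (u' i) (u' j) (u k)) (quant_wedge L [twist u i, twist u j, u' k])))"
    and "\<Lambda> (op_a_bar L B s u u') = scal (- 1 / 4) (\<Lambda> (\<Sum>i<s. \<Sum>j<s. \<Sum>k<s.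
      scal (cubic_coeff (u i) (u j) (u' k)) (quant_wedge L [u' i, u' j, twist u k])))"
proof -
  interpret \<Lambda>: Vector_Spaces.linear scal scal \<Lambda>
    using \<Lambda> by (simp add: wedge_linear_def)
  have u: "u i \<in> hom_elems L S" "u' i \<in> hom_elems L S" "par L (u' i) = par L (u i)" if "i < s" for i
    using assms(2) that by (auto simp: hom_family_def)
  show "\<Lambda> (op_a L B s u u') = scal (- 1 / 4) (\<Lambda> (\<Sum>i<s. \<Sum>j<s. \<Sum>k<s.
      scal (cubic_coeff (u' i) (u' j) (u k)) (quant_wedge L [twist u i, twist u j, u' k])))"
    unfolding op_a_def \<Lambda>.scale \<Lambda>.sum
    by (intro arg_cong[where f = "scal _"] sum.cong refl)
      (simp add: wedge_linear_twist[OF \<Lambda>] u cubic_coeff_def power_add mult_ac)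
  show "\<Lambda> (op_a_bar L B s u u') = scal (- 1 / 4) (\<Lambda> (\<Sum>i<s. \<Sum>j<s. \<Sum>k<s.
      scal (cubic_coeff (u i) (u j) (u' k)) (quant_wedge L [u' i, u' j, twist u k])))"
    unfolding op_a_bar_def \<Lambda>.scale \<Lambda>.sum
  proof (intro arg_cong[where f = "scal _"] sum.cong refl)
    fix i j k assume "i \<in> {..<s}" "j \<in> {..<s}" "k \<in> {..<s}"
    \<comment> \<open>The sign of the third argument in \<open>cubic_coeff\<close> cancels that of
      the twisted factor, which is why the conjugate of \<open>a\<close> has neither.\<close>
    moreover have "(-1) ^ par L (u k) * (-1) ^ par L (u k) = (1 :: complex)"
      by (rule minus_one_power_mult_self)
    ultimately show "scal ((-1) ^ (par L (u i) * par L (u j)) * B (bracket L (u i) (u j)) (u' k))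
        (\<Lambda> (quant_wedge L [u' i, u' j, u k])) =
      scal (cubic_coeff (u i) (u j) (u' k)) (\<Lambda> (quant_wedge L [u' i, u' j, twist u k]))"
      by (simp add: wedge_linear_twist[OF \<Lambda>] u cubic_coeff_def power_add mult_ac)
  qed
qed

lemma wedge_linear_proj: "wedge_linear (\<lambda>a. proj (tensor 1 a))"
  unfolding wedge_linear_def W_def[symmetric]
proof (intro conjI allI impI)
  show "Vector_Spaces.linear scal scal (\<lambda>a. proj (tensor 1 a))"
    using Vector_Spaces.linear_compose[OF linear_tensor_right linear_proj] by (simp add: comp_def)
qed (auto simp: hom_elems_iff hlin_W intro!: hlin_scale[of "\<lambda>x. W x _ _"] hlin_scale[of "\<lambda>x. W _ x _"] hlin_scale[of "\<lambda>x. W _ _ x"])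

lemma proj_op_C:
  assumes u: "hom_family (s, u, u')"
  shows "proj (op_C L B s u u') = (\<Sum>i<s. P (u i) (u' i))
      + scal (- 1 / 4) (cubic (s, u', twist u) (s, u', twist u) (s, u, u'))"
    and "proj (op_C_bar L B s u u') = (\<Sum>i<s. P (u' i) (twist u i))
      + scal (- 1 / 4) (cubic (s, u, u') (s, u, u') (s, u', twist u))"
proof -
  interpret t: Vector_Spaces.linear scal scal "tensor (1 :: 'g free)" by (rule linear_tensor_right)
  have "P (u' i) (twist u i) = scal ((-1) ^ par L (u i)) (P (u' i) (u i))" if "i < s" for i
  proof -
    have "u i \<in> S" "u i \<in> part L (par L (u i))" "u' i \<in> hom_elems L S"
      using u that by (auto simp: hom_family_def hom_elems_iff)
    then show ?thesis
      unfolding twist_def using hlin_scale[OF hlin_P(2)] by blast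
  qed
  then have "proj (op_A_bar L s u u') = (\<Sum>i<s. P (u' i) (twist u i))"
    by (simp add: op_A_bar_def proj.sum proj.scale P_def)
  moreover have "proj (op_A s u u') = (\<Sum>i<s. P (u i) (u' i))"
    by (simp add: op_A_def proj.sum P_def)
  ultimately show "proj (op_C L B s u u') = (\<Sum>i<s. P (u i) (u' i))
      + scal (- 1 / 4) (cubic (s, u', twist u) (s, u', twist u) (s, u, u'))"
    and "proj (op_C_bar L B s u u') = (\<Sum>i<s. P (u' i) (twist u i))
      + scal (- 1 / 4) (cubic (s, u, u') (s, u, u') (s, u', twist u))"
    unfolding op_C_def op_C_bar_def proj.add wedge_linear_op_a[OF wedge_linear_proj u] cubic.simps
    by (simp_all only: t.sum t.scale proj.sum proj.scale W_def)
qed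

lemma proj_cubic_dirac:
  "proj (cubic_dirac L B m X X') = (\<Sum>i<m. P (X i) (X' i))
    + scal (- 1 / 12) (cubic (m, X, X') (m, X, X') (m, X, X'))"
proof -
  interpret t: Vector_Spaces.linear scal scal "tensor (1 :: 'g free)" by (rule linear_tensor_right)
  show ?thesis
    by (simp only: cubic_dirac_def dirac_cubic_def proj.add t.sum t.scale proj.sum proj.scale
        W_def P_def cubic.simps cubic_coeff_def)
qed

end

context levi_action
begin

text \<open>Linearity of \<open>\<delta>\<close> on representatives does not give the scaling laws.
  The formula \<open>\<delta>_W\<close> reduces them to those of \<open>W\<close>.\<close>

lemma wedge_linear_\<delta>: "wedge_linear (\<lambda>a. \<delta> (tensor 1 a))"
  unfolding wedge_linear_def
proof (intro conjI allI impI)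
  show "Vector_Spaces.linear scal scal (\<lambda>a. \<delta> (tensor 1 a))"
    using Vector_Spaces.linear_compose[OF linear_tensor_right \<delta>.linear_axioms] by (simp add: comp_def)
next
  fix c :: complex and x y z
  assume c: "c \<noteq> 0" and xyz: "x \<in> hom_elems L S" "y \<in> hom_elems L S" "z \<in> hom_elems L S"
  have W: "W (lscale L c x) y z = scal c (W x y z)" "W x (lscale L c y) z = scal c (W x y z)"
    "W x y (lscale L c z) = scal c (W x y z)"
    if "x \<in> hom_elems L S" "y \<in> hom_elems L S" "z \<in> hom_elems L S" for x y z
    using wedge_linear_proj c that unfolding wedge_linear_def W_def by blast+
  note simps = \<delta>_W W xyz hom_elems_scale bracket_X_hom bracket_scale_right par_scale[OF c]
    scal.scale_right_distrib mult.commute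
  show "\<delta> (tensor 1 (quant_wedge L [lscale L c x, y, z])) = scal c (\<delta> (tensor 1 (quant_wedge L [x, y, z])))"
    "\<delta> (tensor 1 (quant_wedge L [x, lscale L c y, z])) = scal c (\<delta> (tensor 1 (quant_wedge L [x, y, z])))"
    "\<delta> (tensor 1 (quant_wedge L [x, y, lscale L c z])) = scal c (\<delta> (tensor 1 (quant_wedge L [x, y, z])))"
    by (simp_all add: simps)
qed

text \<open>The two Leibniz terms of \<open>\<delta>_P\<close> are the two sides of
  \<open>casimir\<close> for the bilinear map \<open>P\<close>.\<close>

lemma \<delta>_dual_pair:
  assumes e: "dual_pair V V' m e e'"
    and stable: "\<And>x. x \<in> V \<Longrightarrow> bracket L X x \<in> V" "\<And>x. x \<in> V' \<Longrightarrow> bracket L X x \<in> V'"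
  shows "(\<Sum>i<m. \<delta> (tensor (gen (e i)) (gen (e' i)))) = 0"
  using casimir[OF e stable hbilin_P] dual_pairD(3,4)[OF e] by (simp add: \<delta>_P sum.distrib)

lemma \<delta>_op_C:
  assumes u: "dual_pair U U' s u u'" "subspace U"
    and stable: "\<And>x. x \<in> U \<Longrightarrow> bracket L X x \<in> U" "\<And>x. x \<in> U' \<Longrightarrow> bracket L X x \<in> U'"
  shows "\<delta> (op_C L B s u u') = 0" "\<delta> (op_C_bar L B s u u') = 0"
proof -
  note v = dual_pair_twist[OF u]
  have fam: "hom_family (s, u, u')" using dual_pair_hom_family u by blast
  note uD = dual_pairD[OF u(1)]
  have "\<delta> (tensor (gen (u' i)) (gen (twist u i))) = scal ((-1) ^ par L (u i)) (\<delta> (tensor (gen (u' i)) (gen (u i))))"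
    if "i < s" for i
  proof -
    have P: "P y (lscale L c x) = scal c (P y x)" if "x \<in> hom_elems L S" "y \<in> hom_elems L S" for x y c
      using hlin_scale[OF hlin_P(2)[OF that(2)], of x _ c] that(1) hom_elems_iff by blast
    show ?thesis
      using uD(3,4)[OF that]
      by (simp add: twist_def \<delta>_P hom_elems_scale bracket_scale_right P bracket_X_hom
          scal.scale_right_distrib mult.commute)
  qed
  then have "\<delta> (op_A_bar L s u u') = 0"
    using \<delta>_dual_pair[OF v stable(2,1)] by (simp add: op_A_bar_def \<delta>.sum \<delta>.scale)
  moreover have "\<delta> (op_A s u u') = 0"
    using \<delta>_dual_pair[OF u(1) stable] by (simp add: op_A_def \<delta>.sum)
  moreover have "\<delta> (tensor 1 (op_a L B s u u')) = 0"
    unfolding wedge_linear_op_a(1)[OF wedge_linear_\<delta> fam]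
    by (subst cubic_invariant[OF v v u(1)]) (auto intro: stable)
  moreover have "\<delta> (tensor 1 (op_a_bar L B s u u')) = 0"
    unfolding wedge_linear_op_a(2)[OF wedge_linear_\<delta> fam]
    by (subst cubic_invariant[OF u(1) u(1) v]) (auto intro: stable)
  ultimately show "\<delta> (op_C L B s u u') = 0" "\<delta> (op_C_bar L B s u u') = 0"
    by (simp_all add: op_C_def op_C_bar_def \<delta>.add)
qed

end

theorem theorem3p1p10:
  fixes L :: "('g::ab_group_add) lsa"
    and B :: "'g \<Rightarrow> 'g \<Rightarrow> complex"
    and h :: "'g set"
    and f :: "('g \<Rightarrow> complex) \<Rightarrow> int"
    and s :: nat
    and X X' u u' :: "nat \<Rightarrow> 'g"
    and \<nu> :: "'g \<Rightarrow> 'g free"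
  defines "S \<equiv> complement L h f"
  assumes "basic_classical L"
    and "invariant_form L B"
    and "cartan_subalgebra L h"
    and "additive_on_lattice L h f"
    and "homogeneous_basis L S (2 * s) X"
    and "dual_basis L B S (2 * s) X X'"
    and "homogeneous_basis L (nilrad L h f) s u"
    and "dual_basis L B (opp_nilrad L h f) s u u'"
    and "is_nu L B S (levi L h f) \<nu>"
  shows "uc_eq L B S (cubic_dirac L B (2 * s) X X') (op_C L B s u u' + op_C_bar L B s u u') \<and>
    l_invariant L B S (levi L h f) \<nu> (op_C L B s u u') \<and>
    l_invariant L B S (levi L h f) \<nu> (op_C_bar L B s u u')"
proof -
  interpret lie_superalgebra L
    using \<open>basic_classical L\<close> by (simp add: basic_classical_def)
  interpret parabolic L B h f
    by unfold_locales (fact \<open>invariant_form L B\<close> \<open>cartan_subalgebra L h\<close> \<open>additive_on_lattice L h f\<close>)+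
  let ?U = "nilrad L h f" and ?U' = "opp_nilrad L h f"
  have S: "S = {x + y | x y. x \<in> ?U \<and> y \<in> ?U'}"
    by (simp add: S_def complement_def)
  interpret clifford_setting L B S
    by unfold_locales (simp add: S subspace_sums subspace_nilrad subspace_opp_nilrad)
  have "?U \<subseteq> S" "?U' \<subseteq> S"
    using subspace_0[OF subspace_nilrad] subspace_0[OF subspace_opp_nilrad] unfolding S by force+
  then have u: "dual_pair ?U ?U' s u u'"
    by (intro dual_basis_dual_pair assms graded_opp_nilrad)
  have X: "dual_pair S S (2 * s) X X'"
    by (intro dual_basis_dual_pair order_refl assms
        homogeneous_basis_graded[OF \<open>homogeneous_basis L S (2 * s) X\<close>])
  note fam = dual_pair_hom_family[OF u]
  have "(\<Sum>i<2 * s. P (X i) (X' i)) = (\<Sum>i<s. P (u i) (u' i)) + (\<Sum>i<s. P (u' i) (twist u i))"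
    by (intro sum_dual_pair_split[OF X u subspace_nilrad S] form_nilrad form_opp_nilrad hbilin_P)
  moreover have "cubic (2 * s, X, X') (2 * s, X, X') (2 * s, X, X') =
      scal 3 (cubic (s, u, u') (s, u, u') (s, u', twist u)
        + cubic (s, u', twist u) (s, u', twist u) (s, u, u'))"
    by (intro cubic_decompose[OF X u subspace_nilrad S] form_nilrad form_opp_nilrad
        form_bracket_nilrad form_bracket_opp_nilrad)
  \<comment> \<open>Here -1/12 times the factor 3 of the cube gives the -1/4 of both
    \<open>a\<close> and its conjugate.\<close>
  ultimately have "proj (cubic_dirac L B (2 * s) X X') = proj (op_C L B s u u' + op_C_bar L B s u u')"
    by (simp add: proj.add proj_op_C[OF fam] proj_cubic_dirac scal.scale_right_distrib del: cubic.simps)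
  moreover have "proj (tensor_supercomm L (tensor (gen Y) 1 + tensor 1 (\<nu> Y)) (op_C L B s u u')) = 0 \<and>
      proj (tensor_supercomm L (tensor (gen Y) 1 + tensor 1 (\<nu> Y)) (op_C_bar L B s u u')) = 0"
    if Y: "Y \<in> hom_elems L (levi L h f)" for Y
  proof -
    have levi: "Y \<in> levi L h f" using Y by (simp add: hom_elems_def)
    interpret levi_action L B S Y "\<nu> Y"
    proof unfold_locales
      show "Y \<in> hom_elems L UNIV" using Y by (rule hom_elems_UNIV)
      show "bracket L Y v \<in> S" if "v \<in> S" for v
        using that bracket_levi_nilrad[OF levi] bracket_levi_opp_nilrad[OF levi]
        unfolding S by (fastforce simp: bracket_add_right)
      show "supercomm L (\<nu> Y) (gen v) - gen (bracket L Y v) \<in> clifford_ideal L B S"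
        if "v \<in> hom_elems L S" for v
        using \<open>is_nu L B S (levi L h f) \<nu>\<close> Y that by (simp add: is_nu_def Let_def)
    qed
    show ?thesis
      using \<delta>_op_C[OF u subspace_nilrad bracket_levi_nilrad[OF levi] bracket_levi_opp_nilrad[OF levi]]
      by (simp add: \<delta>_def)
  qed
  ultimately show ?thesis
    by (simp add: l_invariant_def uc_eq_iff)
qed

end
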